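(* Let $\mathcal F$ be an inversive difference field of characteristic zero and let $\mathcal I\subset\mathcal F\{\mathbb Y^{\pm}\}$. Then $\mathcal I$ is a proper Laurent binomial difference ideal if and only if (1) holds, if and only if (2) holds, if and only if (3) holds, where: (1) $\mathcal I=[\mathcal A]$, where $\mathcal A:\ \mathbb Y^{\mathbf f_1}-c_1,\ldots,\mathbb Y^{\mathbf f_s}-c_s$ with $\mathbf f_i\in\mathbb Z[x]^n$, $c_i\in\mathcal F^*=\mathcal F\setminus\{0\}$, the set $\{\mathbf f_1,\ldots,\mathbf f_s\}$ is a reduced Gröbner basis of a $\mathbb Z[x]$-lattice, and $[\mathcal A]\neq[1]$. (2) $\mathcal I=[\mathcal A]$, where $\mathcal A:\ \mathbb Y^{\mathbf f_1}-c_1,\ldots,\mathbb Y^{\mathbf f_s}-c_s$ with $\mathbf f_i\in\mathbb Z[x]^n$, $c_i\in\mathcal F^*$, and $\mathcal A$ is a regular and coherent difference ascending chain. (3) There are $\mathbf f_1,\ldots,\mathbf f_s\in\mathbb Z[x]^n$ and $c_1,\ldots,c_s\in\mathcal F^*$ such that $\mathcal I=\mathcal I(\rho)=[\mathbb Y^{\mathbf f}-\rho(\mathbf f)\mid \mathbf f\in L_\rho]$, where $\rho$ is a homomorphism from the $\mathbb Z[x]$-lattice $L_\rho$ generated by $\mathbf f_1,\ldots,\mathbf f_s$ to the multiplicative group $\mathcal F^*$ satisfying $\rho(\mathbf f_i)=c_i$ for all $i$ and $\rho(x\mathbf f)=\sigma(\rho(\mathbf f))$ for all $\mathbf f\in L_\rho$.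 Moreover, in (1) and (2), $\mathcal A$ is a characteristic set of the difference ideal $\mathcal I$.
   Context: A difference field ($\sigma$-field) is a field $\mathcal F$ with an operation $\sigma$ such that $\sigma(a+b)=\sigma(a)+\sigma(b)$, $\sigma(ab)=\sigma(a)\sigma(b)$, and $\sigma(a)=0$ iff $a=0$; it is inversive if $\sigma^{-1}(a)$ is defined for each $a\in\mathcal F$. $\mathbb Y=\{y_1,\ldots,y_n\}$ are difference indeterminates, $y_i^{(j)}=\sigma^j(y_i)$, and $\mathbb N$ contains $0$. For $p=\sum_i c_ix^i\in\mathbb Z[x]$, $a^p:=\prod_i\sigma^i(a)^{c_i}$; for $\mathbf f=(f_1,\ldots,f_n)^\tau\in\mathbb Z[x]^n$, $\mathbb Y^{\mathbf f}:=\prod_i y_i^{f_i}$ (a Laurent $\sigma$-monomial). $\mathcal F\{\mathbb Y^{\pm}\}$ is the ring of Laurent difference polynomials, i.e. $\mathcal F$-linear combinations of Laurent $\sigma$-monomials. A $\sigma$-ideal is an ideal $\mathcal I$ with $\sigma(\mathcal I)\subset\mathcal I$; $[S]$ is the $\sigma$-ideal generated by $S$; proper means $\ne[1]$. A Laurent $\sigma$-binomial is an element $a\mathbb Y^{\mathbf g}+b\mathbb Y^{\mathbf h}$, $a,b\in\mathcal F$; a Laurent binomial difference ideal is a $\sigma$-ideal of $\mathcal F\{\mathbb Y^\pm\}$ generated by Laurent $\sigma$-binomials. A $\mathbb Z[x]$-lattice is a $\mathbb Z[x]$-submodule of $\mathbb Z[x]^n$. **Gröbner bases.** Let $\epsilon_i$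 be the standard basis vectors of $\mathbb Z[x]^n$. Monomials $ax^k\epsilon_i$ ($a\in\mathbb Z$, $k\in\mathbb N$) are ordered by $ax^\alpha\epsilon_i>bx^\beta\epsilon_j$ if $i>j$, or $i=j$ and $\alpha>\beta$, or $i=j$, $\alpha=\beta$, $|a|>|b|$. Writing $\mathbf f$ as the sum of its nonzero monomials (with distinct $x^k\epsilon_i$), the leading term $\mathbf{LT}(\mathbf f)$ is the largest of them; $\mathbf{LT}(G)$ is the set of leading terms of the elements of $G$. A finite set $F\subset\mathbb Z[x]^n$ is a Gröbner basis for the $\mathbb Z[x]$-lattice $L$ generated by $F$ if $(\mathbf{LT}(L))=(\mathbf{LT}(F))$, where $(\cdot)$ denotes the generated $\mathbb Z[x]$-module. A vector $\mathbf f$ is G-reduced with respect to a set $G$ if no monomial of $\mathbf f$ is a multiple of $\mathbf{LT}(\mathbf g)$ by an element of $\mathbb Z[x]$, for any $\mathbf g\in G$. A Gröbner basis $F$ is reduced if each $\mathbf f\in F$ is G-reduced with respect to $F\setminus\{\mathbf f\}$. **Normal form.** $\mathbf f=(f_1,\ldots,f_n)^\tau\in\mathbb Z[x]^n$ is normal if the leading coefficient of $f_s$ is positive, $s$ being the largest index with $f_s\ne0$. $\mathbb Y^{\mathbf f}-c$ ($c\in\mathcal F^*$) is in normal form if $\mathbf f$ is normal; $\mathbf f$ is its support. Every Laurent $\sigma$-binomial that is not a unit is uniquely $aM(\mathbb Y^{\mathbf f}-c)$ with $a\in\mathcal F^*$, $M$ a Laurent $\sigma$-monomial and $\mathbb Y^{\mathbf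 f}-c$ in normal form; by convention Laurent $\sigma$-binomials are always represented by their normal form. The inverse of $\mathbb Y^{\mathbf f}-c$ is $\mathbb Y^{-\mathbf f}-c^{-1}$. **Chains.** Order the $y_i^{(k)}$ by $y_i^{(k)}>y_j^{(l)}$ iff $i>j$, or $i=j$ and $k>l$. The leader of $f$ is the greatest $y_j^{(k)}$ appearing effectively in $f$; then $y_j$ is the leading variable, and the initial is the leading coefficient of $f$ as a univariate polynomial in its leader; $\mathrm{ord}(f,y_i)$ is the greatest $k$ such that $y_i^{(k)}$ appears effectively in $f$. $q$ has higher rank than $p$ (written $q>p$) if the leader of $q$ is larger than that of $p$, or both leaders equal $y_j^{(k)}$ and $|\deg(q,y_j^{(k)})|>|\deg(p,y_j^{(k)})|$. If $p$ has leader $y_j^{(k)}$, $q$ is reduced w.r.t. $p$ if $|\deg(q,y_j^{(k+l)})|<|\deg(p,y_j^{(k)})|$ for all $l\in\mathbb N$; $q$ is reduced w.r.t. a chain if it is reduced w.r.t. each of its elements. A difference ascending chain is a finite sequence $A_1,\ldots,A_m$ of nonzero elements such that either $m=1$, or $m>1$ and $A_j>A_i$ and $A_j$ is reduced w.r.t. $A_i$ for all $1\le i<j\le m$. With $I_i$ the initial and $y_{l_i}^{(o_i)}$ the leader of $A_i$, the chain is regular if for every $i$ and every $j\in\mathbb N$, $\sigma^j(I_i)$ is invertible w.r.t. the chain, in the sense that $[A_1,\ldots,A_{i-1},\sigma^j(I_i)]$ contains a nonzero difference polynomial involving no $y_{l_i}^{(o_i+k)}$, $k=0,1,\ldots$ (for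 Laurent binomial chains the initials are Laurent $\sigma$-monomials, hence units). **Remainders and coherence.** Let $f=\mathbb Y^{\mathbf f}-c_f$ and let $g=\mathbb Y^{\mathbf g}-c_g$ be in normal form with leading variable $y_l$. First suppose $\mathrm{ord}(f,y_l)=\mathrm{ord}(g,y_l)=o$, and let $d_g>0$ and $d_f$ be the degrees of $g$ and $f$ in $y_l^{(o)}$. While $|d_f|\ge d_g$: if $d_f\ge0$ replace $f$ by $\mathbb Y^{\mathbf f-\mathbf g}-c_f/c_g$; if $d_f<0$ replace $f$ by $\mathbb Y^{\mathbf f+\mathbf g}-c_fc_g$. The final result, or its inverse if it is not in normal form, is $\mathrm{prem}(f,g)$ (if the support becomes $0$, the result is the constant $1-c$, with $c$ the final constant). In general, $\mathrm{prem}(f,g)=f$ if $f$ is reduced w.r.t. $g$; otherwise, with $o_f=\mathrm{ord}(f,y_l)$, $o_g=\mathrm{ord}(g,y_l)$, $\mathrm{prem}(f,g)=\mathrm{prem}(\ldots\mathrm{prem}(\mathrm{prem}(f,\sigma^{o_f-o_g}(g)),\sigma^{o_f-o_g-1}(g)),\ldots,g)$. For a chain $\mathcal A=A_1,\ldots,A_s$, $\mathrm{prem}(f,\mathcal A)=\mathrm{prem}(\ldots\mathrm{prem}(\mathrm{prem}(f,A_s),A_{s-1}),\ldots,A_1)$. For $i<j$, $\Delta(A_i,A_j)=0$ if $A_i,A_j$ have distinct leading variables; if they have the same leading variable $y_l$, then $o_i=\mathrm{ord}(A_i,y_l)<o_j=\mathrm{ord}(A_j,y_l)$ and $\Delta(A_i,A_j)=\mathrm{prem}(\sigma^{o_j-o_i}(A_i),A_j)$.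 The chain is coherent if $\mathrm{prem}(\Delta(A_i,A_j),\mathcal A)=0$ for all $i<j$. **Characteristic set.** A difference ascending chain $\mathcal A$ contained in $\mathcal I$ is a characteristic set of $\mathcal I$ if $\mathcal I$ does not contain any nonzero element reduced w.r.t. $\mathcal A$.
   Formalization: In (1), A is shown characteristic only if listed by increasing leading terms, each LT in the lattice is a multiple of one LT(f_i), and coefficients are reduced in absolute value (false otherwise: {2,3}). The empty chain is allowed for I=0; |deg| is largest minus smallest exponent. *)

theory Defs
  imports
    "HOL-Analysis.Finite_Cartesian_Product"
    "HOL-Computational_Algebra.Polynomial"
    "HOL-Library.Poly_Mapping"
begin

section \<open>Difference fields\<close>

locale difference_field =
  fixes \<sigma> :: "'a::field \<Rightarrow> 'a"
  assumes sigma_add: "\<sigma> (a + b) = \<sigma> a + \<sigma> b"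
    and sigma_mult: "\<sigma> (a * b) = \<sigma> a * \<sigma> b"
    and sigma_eq_0_iff: "\<sigma> a = 0 \<longleftrightarrow> a = 0"

locale inversive_difference_field = difference_field +
  assumes sigma_surj: "surj \<sigma>"


section \<open>Laurent difference polynomials\<close>

text \<open>
  The index type \<open>'n\<close> is finite and linearly ordered; it stands for \<open>1 < \<dots> < n\<close>.
  Vectors \<open>f\<close> over the integer polynomials index the Laurent monomials \<open>Y^f\<close>; since
  \<open>Y^f Y^g = Y^(f+g)\<close>, with distinct \<open>f\<close> giving linearly independent monomials,
  the ring of Laurent difference polynomials is the group ring of the additive group of these
  vectors over the coefficient field.  A variable \<open>y_i^(k)\<close> is encoded as the pair \<open>(i, k)\<close>;
  its exponent in \<open>Y^f\<close> is the coefficient of \<open>x^k\<close> in \<open>f $ i\<close>.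
\<close>

type_synonym 'n zvec = "(int poly, 'n) vec"
type_synonym ('a, 'n) laurent = "'n zvec \<Rightarrow>\<^sub>0 'a"

definition shift :: "('n::finite) zvec \<Rightarrow> 'n zvec" where
  "shift f = [:0, 1:] *s f"

definition lmonom :: "('n::finite) zvec \<Rightarrow> ('a::field, 'n) laurent" where
  "lmonom f = Poly_Mapping.single f 1"

definition lconst :: "'a::field \<Rightarrow> ('a, 'n::finite) laurent" where
  "lconst a = Poly_Mapping.single 0 a"

text \<open>The extension of \<open>\<sigma>\<close>: it sends \<open>a Y^f\<close> to \<open>\<sigma> a Y^(x f)\<close>.\<close>

definition lsigma :: "('a::field \<Rightarrow> 'a) \<Rightarrow> ('a, 'n::finite) laurent \<Rightarrow> ('a, 'n) laurent" where
  "lsigma \<sigma> p =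
     (\<Sum>f\<in>Poly_Mapping.keys p. Poly_Mapping.single (shift f) (\<sigma> (Poly_Mapping.lookup p f)))"

definition sigma_ideal :: "('a::field \<Rightarrow> 'a) \<Rightarrow> ('a, 'n::finite) laurent set \<Rightarrow> bool" where
  "sigma_ideal \<sigma> I \<longleftrightarrow>
     0 \<in> I \<and> (\<forall>p\<in>I. \<forall>q\<in>I. p + q \<in> I) \<and> (\<forall>r. \<forall>p\<in>I. r * p \<in> I) \<and> lsigma \<sigma> ` I \<subseteq> I"

definition gen_sigma_ideal ::
    "('a::field \<Rightarrow> 'a) \<Rightarrow> ('a, 'n::finite) laurent set \<Rightarrow> ('a, 'n) laurent set" where
  "gen_sigma_ideal \<sigma> S = sigma_ideal \<sigma> hull S"

definition laurent_binomial :: "('a::field, 'n::finite) laurent \<Rightarrow> bool" where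
  "laurent_binomial p \<longleftrightarrow> (\<exists>a g b h. p = lconst a * lmonom g + lconst b * lmonom h)"

definition laurent_binomial_ideal ::
    "('a::field \<Rightarrow> 'a) \<Rightarrow> ('a, 'n::finite) laurent set \<Rightarrow> bool" where
  "laurent_binomial_ideal \<sigma> I \<longleftrightarrow> (\<exists>S. (\<forall>p\<in>S. laurent_binomial p) \<and> I = gen_sigma_ideal \<sigma> S)"

definition proper_ideal :: "('a::field \<Rightarrow> 'a) \<Rightarrow> ('a, 'n::finite) laurent set \<Rightarrow> bool" where
  "proper_ideal \<sigma> I \<longleftrightarrow> I \<noteq> gen_sigma_ideal \<sigma> {1}"


section \<open>Lattices and Groebner bases\<close>

lemma module_zvec: "module ((*s) :: int poly \<Rightarrow> ('n::finite) zvec \<Rightarrow> 'n zvec)"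
  by unfold_locales (simp_all add: vec_eq_iff algebra_simps)

abbreviation zx_span :: "('n::finite) zvec set \<Rightarrow> 'n zvec set" where
  "zx_span \<equiv> module.span (*s)"

text \<open>A triple \<open>(a, k, i)\<close> encodes the monomial \<open>a x^k \<epsilon>_i\<close>.\<close>

type_synonym 'n zmon = "int \<times> nat \<times> 'n"

definition mon_vec :: "('n::finite) zmon \<Rightarrow> 'n zvec" where
  "mon_vec m = (case m of (a, k, i) \<Rightarrow> axis i (monom a k))"

definition mon_less :: "('n::{finite,linorder}) zmon \<Rightarrow> 'n zmon \<Rightarrow> bool" where
  "mon_less m' m = (case m' of (b, l, j) \<Rightarrow> case m of (a, k, i) \<Rightarrow>
     j < i \<or> j = i \<and> (l < k \<or> l = k \<and> \<bar>b\<bar> < \<bar>a\<bar>))"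

definition mons :: "('n::finite) zvec \<Rightarrow> 'n zmon set" where
  "mons f = {(a, k, i). a = poly.coeff (f $ i) k \<and> a \<noteq> 0}"

definition LT :: "('n::{finite,linorder}) zvec \<Rightarrow> 'n zmon" where
  "LT f = (THE m. m \<in> mons f \<and> (\<forall>m'\<in>mons f. m' \<noteq> m \<longrightarrow> mon_less m' m))"

definition LT_set :: "('n::{finite,linorder}) zvec set \<Rightarrow> 'n zvec set" where
  "LT_set G = (\<lambda>f. mon_vec (LT f)) ` (G - {0})"

definition mon_multiple :: "('n::finite) zmon \<Rightarrow> 'n zmon \<Rightarrow> bool" where
  "mon_multiple m m' \<longleftrightarrow> (\<exists>p. mon_vec m = p *s mon_vec m')"

definition groebner_basis :: "('n::{finite,linorder}) zvec set \<Rightarrow> bool" where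
  "groebner_basis F \<longleftrightarrow> finite F \<and> zx_span (LT_set (zx_span F)) = zx_span (LT_set F)"

definition G_reduced :: "('n::{finite,linorder}) zvec \<Rightarrow> 'n zvec set \<Rightarrow> bool" where
  "G_reduced f G \<longleftrightarrow> (\<forall>m\<in>mons f. \<forall>g\<in>G - {0}. \<not> mon_multiple m (LT g))"

definition reduced_groebner_basis :: "('n::{finite,linorder}) zvec set \<Rightarrow> bool" where
  "reduced_groebner_basis F \<longleftrightarrow> groebner_basis F \<and> (\<forall>f\<in>F. G_reduced f (F - {f}))"

text \<open>
  A Groebner basis in the above sense may be the set \<open>{2, 3}\<close> (dimension one), and a reduced one
  may be \<open>{4, 2x + 6}\<close>, because 6 is not a multiple of 4.  The following is the sharper form in
  which leading terms of lattice elements are multiples of single leading terms, and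
  coefficients above a leading coefficient are smaller than it, as they are for the corresponding
  binomials in an ascending chain.
\<close>

definition sharply_reduced :: "('n::{finite,linorder}) zvec set \<Rightarrow> bool" where
  "sharply_reduced F \<longleftrightarrow>
     (\<forall>h\<in>zx_span F - {0}. \<exists>f\<in>F - {0}. mon_multiple (LT h) (LT f)) \<and>
     (\<forall>f\<in>F. \<forall>g\<in>F - {f, 0}. \<forall>(a, k, i)\<in>mons f.
        case LT g of (b, l, j) \<Rightarrow> i = j \<and> l \<le> k \<longrightarrow> \<bar>a\<bar> < \<bar>b\<bar>)"


section \<open>Binomials in normal form\<close>

text \<open>For \<open>f \<noteq> 0\<close>, the largest index with a nonzero component.\<close>

definition top_index :: "('n::{finite,linorder}) zvec \<Rightarrow> 'n" where
  "top_index f = Max {i. f $ i \<noteq> 0}"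

definition normal :: "('n::{finite,linorder}) zvec \<Rightarrow> bool" where
  "normal f \<longleftrightarrow> f \<noteq> 0 \<and> 0 < lead_coeff (f $ top_index f)"

text \<open>
  The pair \<open>(f, c)\<close> encodes \<open>Y^f - c\<close>.  In particular \<open>(0, c)\<close> is the constant \<open>1 - c\<close>,
  and \<open>(0, 1)\<close> is zero.
\<close>

type_synonym ('a, 'n) binom = "'n zvec \<times> 'a"

definition lbinom :: "('a::field, 'n::finite) binom \<Rightarrow> ('a, 'n) laurent" where
  "lbinom b = lmonom (fst b) - lconst (snd b)"

definition normal_binom :: "('a::field, 'n::{finite,linorder}) binom \<Rightarrow> bool" where
  "normal_binom b \<longleftrightarrow> normal (fst b) \<and> snd b \<noteq> 0"

definition to_normal :: "('a::field, 'n::{finite,linorder}) binom \<Rightarrow> ('a, 'n) binom" where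
  "to_normal b = (if fst b = 0 \<or> normal (fst b) then b else (- fst b, inverse (snd b)))"

definition sigma_binom :: "('a::field \<Rightarrow> 'a) \<Rightarrow> ('a, 'n::finite) binom \<Rightarrow> ('a, 'n) binom" where
  "sigma_binom \<sigma> b = (shift (fst b), \<sigma> (snd b))"


section \<open>Difference ascending chains\<close>

type_synonym 'n lvar = "'n \<times> nat"

definition var_less :: "('n::linorder) lvar \<Rightarrow> 'n lvar \<Rightarrow> bool" where
  "var_less v w \<longleftrightarrow> fst v < fst w \<or> fst v = fst w \<and> snd v < snd w"

definition expo :: "('n::finite) zvec \<Rightarrow> 'n lvar \<Rightarrow> int" where
  "expo f v = poly.coeff (f $ fst v) (snd v)"

text \<open>
  The absolute degree \<open>\<bar>deg(q, v)\<bar>\<close>.  A Laurent difference polynomial is considered up to the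
  units \<open>Y^f\<close>: up to such a factor it is a difference polynomial divisible by no variable, and
  its degree in \<open>v\<close> is then the difference between the largest and the smallest exponent of \<open>v\<close>.
  For a binomial \<open>Y^f - c\<close> this is the absolute value of the exponent of \<open>v\<close> in \<open>Y^f\<close>;
  see \<open>absdeg_lbinom\<close>.
\<close>

definition absdeg :: "('a::field, 'n::finite) laurent \<Rightarrow> 'n lvar \<Rightarrow> int" where
  "absdeg q v = (if q = 0 then 0 else
     Max ((\<lambda>f. expo f v) ` Poly_Mapping.keys q) - Min ((\<lambda>f. expo f v) ` Poly_Mapping.keys q))"

definition appears :: "('a::field, 'n::finite) laurent \<Rightarrow> 'n lvar \<Rightarrow> bool" where
  "appears q v \<longleftrightarrow> absdeg q v \<noteq> 0"

definition is_leader :: "('a::field, 'n::{finite,linorder}) laurent \<Rightarrow> 'n lvar \<Rightarrow> bool" where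
  "is_leader q v \<longleftrightarrow> appears q v \<and> (\<forall>w. appears q w \<and> w \<noteq> v \<longrightarrow> var_less w v)"

definition higher_rank ::
    "('a::field, 'n::{finite,linorder}) laurent \<Rightarrow> ('a, 'n) laurent \<Rightarrow> bool" where
  "higher_rank q p \<longleftrightarrow> (\<exists>v w. is_leader p v \<and> is_leader q w \<and>
     (var_less v w \<or> v = w \<and> absdeg p v < absdeg q v))"

text \<open>Without a leader, \<open>p\<close> is a unit, and nothing is reduced with respect to it.\<close>

definition reduced_wrt ::
    "('a::field, 'n::{finite,linorder}) laurent \<Rightarrow> ('a, 'n) laurent \<Rightarrow> bool" where
  "reduced_wrt q p \<longleftrightarrow> (\<exists>j k. is_leader p (j, k) \<and> (\<forall>l. absdeg q (j, k + l) < absdeg p (j, k)))"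

text \<open>The empty chain is admitted; it belongs to the zero ideal.\<close>

definition ascending_chain :: "('a::field, 'n::{finite,linorder}) laurent list \<Rightarrow> bool" where
  "ascending_chain As \<longleftrightarrow>
     0 \<notin> set As \<and> sorted_wrt (\<lambda>p q. higher_rank q p \<and> reduced_wrt q p) As"

definition initial_wrt :: "('a::field, 'n::finite) laurent \<Rightarrow> 'n lvar \<Rightarrow> ('a, 'n) laurent" where
  "initial_wrt q v =
     (let d = Max ((\<lambda>f. expo f v) ` Poly_Mapping.keys q)
      in \<Sum>f\<in>{f \<in> Poly_Mapping.keys q. expo f v = d}.
           Poly_Mapping.single (f - axis (fst v) (monom d (snd v))) (Poly_Mapping.lookup q f))"

definition difference_polynomial :: "('a::field, 'n::finite) laurent \<Rightarrow> bool" where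
  "difference_polynomial q \<longleftrightarrow> (\<forall>f\<in>Poly_Mapping.keys q. \<forall>v. 0 \<le> expo f v)"

definition regular_chain ::
    "('a::field \<Rightarrow> 'a) \<Rightarrow> ('a, 'n::{finite,linorder}) laurent list \<Rightarrow> bool" where
  "regular_chain \<sigma> As \<longleftrightarrow> (\<forall>i<length As. \<exists>l r. is_leader (As ! i) (l, r) \<and>
     (\<forall>j. \<exists>q\<in>gen_sigma_ideal \<sigma> (insert ((lsigma \<sigma> ^^ j) (initial_wrt (As ! i) (l, r)))
                                      (set (take i As))).
        q \<noteq> 0 \<and> difference_polynomial q \<and>
        (\<forall>f\<in>Poly_Mapping.keys q. \<forall>k. expo f (l, r + k) = 0)))"


section \<open>Remainders and coherence\<close>

text \<open>
  Division of \<open>Y^f - c_f\<close> by \<open>Y^g - c_g\<close> at the variable \<open>v\<close>, where the exponent of \<open>v\<close> in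
  \<open>Y^g\<close> is positive (the guard \<open>0 < d_g\<close> only makes the function total).
\<close>

function prem_loop ::
    "'n lvar \<Rightarrow> ('a::field, 'n::finite) binom \<Rightarrow> ('a, 'n) binom \<Rightarrow> ('a, 'n) binom" where
  "prem_loop v g f =
     (let dg = expo (fst g) v; df = expo (fst f) v in
      if 0 < dg \<and> dg \<le> \<bar>df\<bar> then
        prem_loop v g
          (if 0 \<le> df then (fst f - fst g, snd f / snd g) else (fst f + fst g, snd f * snd g))
      else f)"
  by pat_completeness auto
termination
  by (relation "Wellfounded.measure (\<lambda>(v, g, f). nat \<bar>expo (fst f) v\<bar>)") (auto simp: expo_def)

declare prem_loop.simps [simp del]

text \<open>
  For \<open>o_f = ord(f, y_l)\<close> and \<open>o_g = ord(g, y_l)\<close>, divide successively by \<open>\<sigma>^t g\<close> for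
  \<open>t = o_f - o_g, \<dots>, 0\<close>.  The step for \<open>t\<close> lowers the exponent of the leader \<open>y_l^(o_g + t)\<close> of
  \<open>\<sigma>^t g\<close> also when \<open>y_l\<close>-derivatives of higher order, whose exponents are already
  small, are left over from the preceding steps.  Note that the fold processes its list from the
  right, and that \<open>ord(f, y_l)\<close> is the degree of the \<open>l\<close>-th component of the support.
\<close>

definition prem ::
    "('a::field \<Rightarrow> 'a) \<Rightarrow> ('a, 'n::{finite,linorder}) binom \<Rightarrow> ('a, 'n) binom \<Rightarrow> ('a, 'n) binom" where
  "prem \<sigma> f g =
     (if reduced_wrt (lbinom f) (lbinom g) then f
      else let l = top_index (fst g); o\<^sub>g = Polynomial.degree (fst g $ l);
               o\<^sub>f = Polynomial.degree (fst f $ l)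
        in foldr (\<lambda>t h. to_normal (prem_loop (l, o\<^sub>g + t) ((sigma_binom \<sigma> ^^ t) g) h))
             [0..<Suc (o\<^sub>f - o\<^sub>g)] f)"

definition prem_chain ::
    "('a::field \<Rightarrow> 'a) \<Rightarrow> ('a, 'n::{finite,linorder}) binom \<Rightarrow> ('a, 'n) binom list \<Rightarrow> ('a, 'n) binom"
  where "prem_chain \<sigma> f gs = foldr (\<lambda>g h. prem \<sigma> h g) gs f"

definition Delta ::
    "('a::field \<Rightarrow> 'a) \<Rightarrow> ('a, 'n::{finite,linorder}) binom \<Rightarrow> ('a, 'n) binom \<Rightarrow> ('a, 'n) binom" where
  "Delta \<sigma> f g =
     (let l = top_index (fst g) in
      if top_index (fst f) \<noteq> l then (0, 1)
      else prem \<sigma>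
        ((sigma_binom \<sigma> ^^ (Polynomial.degree (fst g $ l) - Polynomial.degree (fst f $ l))) f) g)"

definition coherent_chain ::
    "('a::field \<Rightarrow> 'a) \<Rightarrow> ('a, 'n::{finite,linorder}) binom list \<Rightarrow> bool" where
  "coherent_chain \<sigma> bs \<longleftrightarrow>
     (\<forall>j<length bs. \<forall>i<j. lbinom (prem_chain \<sigma> (Delta \<sigma> (bs ! i) (bs ! j)) bs) = 0)"


section \<open>Characteristic sets and the three descriptions\<close>

definition characteristic_set ::
    "('a::field, 'n::{finite,linorder}) laurent set \<Rightarrow> ('a, 'n) laurent list \<Rightarrow> bool" where
  "characteristic_set I As \<longleftrightarrow> ascending_chain As \<and> set As \<subseteq> I \<and>
     \<not> (\<exists>q\<in>I. q \<noteq> 0 \<and> (\<forall>p\<in>set As. reduced_wrt q p))"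

definition groebner_presentation ::
    "('a::field \<Rightarrow> 'a) \<Rightarrow> ('a, 'n::{finite,linorder}) laurent set \<Rightarrow> ('a, 'n) binom list \<Rightarrow> bool"
  where
  "groebner_presentation \<sigma> I bs \<longleftrightarrow>
     (\<forall>b\<in>set bs. normal_binom b) \<and> distinct (map fst bs) \<and>
     reduced_groebner_basis (fst ` set bs) \<and>
     I = gen_sigma_ideal \<sigma> (lbinom ` set bs) \<and>
     proper_ideal \<sigma> (gen_sigma_ideal \<sigma> (lbinom ` set bs))"

definition chain_presentation ::
    "('a::field \<Rightarrow> 'a) \<Rightarrow> ('a, 'n::{finite,linorder}) laurent set \<Rightarrow> ('a, 'n) binom list \<Rightarrow> bool"
  where
  "chain_presentation \<sigma> I bs \<longleftrightarrow>
     (\<forall>b\<in>set bs. normal_binom b) \<and>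
     ascending_chain (map lbinom bs) \<and> regular_chain \<sigma> (map lbinom bs) \<and> coherent_chain \<sigma> bs \<and>
     I = gen_sigma_ideal \<sigma> (lbinom ` set bs)"

text \<open>Only the values of \<open>\<rho>\<close> on the lattice \<open>L\<close> matter.\<close>

definition character_on ::
    "('a::field \<Rightarrow> 'a) \<Rightarrow> ('n::finite) zvec set \<Rightarrow> ('n zvec \<Rightarrow> 'a) \<Rightarrow> bool" where
  "character_on \<sigma> L \<rho> \<longleftrightarrow>
     (\<forall>f\<in>L. \<rho> f \<noteq> 0) \<and> (\<forall>f\<in>L. \<forall>g\<in>L. \<rho> (f + g) = \<rho> f * \<rho> g) \<and>
     (\<forall>f\<in>L. \<rho> (shift f) = \<sigma> (\<rho> f))"

definition character_ideal ::
    "('a::field \<Rightarrow> 'a) \<Rightarrow> ('n::finite) zvec set \<Rightarrow> ('n zvec \<Rightarrow> 'a) \<Rightarrow> ('a, 'n) laurent set" where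
  "character_ideal \<sigma> L \<rho> = gen_sigma_ideal \<sigma> {lmonom f - lconst (\<rho> f) | f. f \<in> L}"

definition character_presentation ::
    "('a::field \<Rightarrow> 'a) \<Rightarrow> ('a, 'n::finite) laurent set \<Rightarrow> ('a, 'n) binom list \<Rightarrow> bool" where
  "character_presentation \<sigma> I bs \<longleftrightarrow>
     (\<exists>\<rho>. character_on \<sigma> (zx_span (fst ` set bs)) \<rho> \<and>
        (\<forall>(f, c)\<in>set bs. c \<noteq> 0 \<and> \<rho> f = c) \<and>
        I = character_ideal \<sigma> (zx_span (fst ` set bs)) \<rho>)"


section \<open>Explicit forms\<close>

lemma top_index_nonzero: "f \<noteq> 0 \<Longrightarrow> f $ top_index f \<noteq> 0"
  and top_index_greatest: "top_index f < i \<Longrightarrow> f $ i = 0"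
proof -
  show "f $ top_index f \<noteq> 0" if "f \<noteq> 0"
  proof -
    have "{i. f $ i \<noteq> 0} \<noteq> {}" using that by (auto simp: vec_eq_iff)
    then show ?thesis using Max_in[of "{i. f $ i \<noteq> 0}"] by (auto simp: top_index_def)
  qed
  show "f $ i = 0" if "top_index f < i"
    using that Max_ge[of "{i. f $ i \<noteq> 0}" i] by (fastforce simp: top_index_def not_le[symmetric])
qed

lemma LT_eq:
  assumes "f \<noteq> 0"
  shows "LT f = (lead_coeff (f $ top_index f), Polynomial.degree (f $ top_index f), top_index f)"
    (is "_ = ?m")
  unfolding LT_def
proof (rule the_equality)
  let ?P = "\<lambda>m. m \<in> mons f \<and> (\<forall>m'\<in>mons f. m' \<noteq> m \<longrightarrow> mon_less m' m)"
  have less: "mon_less m' ?m" if "m' \<in> mons f" "m' \<noteq> ?m" for m'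
  proof -
    obtain a k i where m': "m' = (a, k, i)" by (cases m')
    have a: "a = poly.coeff (f $ i) k" "a \<noteq> 0" using that m' by (auto simp: mons_def)
    then have "f $ i \<noteq> 0" "k \<le> Polynomial.degree (f $ i)" by (auto intro: le_degree)
    then have "i \<le> top_index f" using top_index_greatest[of f i] by (meson not_le)
    then show ?thesis
      using a that m' \<open>k \<le> _\<close> by (auto simp: mon_less_def order.order_iff_strict)
  qed
  have mem: "?m \<in> mons f" using top_index_nonzero[OF assms] by (auto simp: mons_def)
  show "?P ?m" using less mem by blast
  show "m = ?m" if "?P m" for m
  proof (rule ccontr)
    assume "m \<noteq> ?m"
    then have "mon_less m ?m" "mon_less ?m m" using that less mem by auto
    then show False by (auto simp: mon_less_def split: prod.splits)
  qed
qed

lemma lbinom_eq_0_iff: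
  fixes b :: "('a::field, 'n::finite) binom"
  shows "lbinom b = 0 \<longleftrightarrow> b = (0, 1)"
proof
  assume "lbinom b = 0"
  then have eq: "Poly_Mapping.single (fst b) (1::'a) = Poly_Mapping.single 0 (snd b)"
    by (simp add: lbinom_def lmonom_def lconst_def)
  have "Poly_Mapping.lookup (Poly_Mapping.single 0 (snd b)) (fst b) = 1"
    by (simp flip: eq)
  then have "fst b = 0" by (auto simp: lookup_single when_def split: if_splits)
  with eq show "b = (0, 1)"
    by (metis inj_single injD prod.collapse)
qed (simp add: lbinom_def lmonom_def lconst_def)

lemma keys_lbinom:
  assumes "fst b \<noteq> 0" "snd b \<noteq> 0"
  shows "Poly_Mapping.keys (lbinom b) = {fst b, 0}"
  using assms
  by (auto simp: lbinom_def lmonom_def lconst_def in_keys_iff lookup_minus lookup_single when_def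
      split: if_splits)

lemma absdeg_lbinom:
  assumes "snd b \<noteq> 0"
  shows "absdeg (lbinom b) v = \<bar>expo (fst b) v\<bar>"
proof (cases "fst b = 0")
  case True
  then have "lbinom b = Poly_Mapping.single 0 (1 - snd b)"
    by (simp add: lbinom_def lmonom_def lconst_def single_diff)
  then show ?thesis using True by (auto simp: absdeg_def expo_def)
next
  case False
  then have "lbinom b \<noteq> 0" by (auto simp: lbinom_eq_0_iff)
  then show ?thesis
    using keys_lbinom[OF False assms] by (simp add: absdeg_def expo_def max_def min_def)
qed

lemma is_leader_lbinom:
  assumes "fst b \<noteq> 0" "snd b \<noteq> 0"
  shows "is_leader (lbinom b) v \<longleftrightarrow>
    v = (top_index (fst b), Polynomial.degree (fst b $ top_index (fst b)))" (is "_ \<longleftrightarrow> v = ?v")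
proof -
  have app: "appears (lbinom b) w \<longleftrightarrow> poly.coeff (fst b $ fst w) (snd w) \<noteq> 0" for w
    by (simp add: appears_def absdeg_lbinom[OF assms(2)] expo_def)
  have less: "var_less w ?v" if "appears (lbinom b) w" "w \<noteq> ?v" for w
  proof -
    have "fst b $ fst w \<noteq> 0" "snd w \<le> Polynomial.degree (fst b $ fst w)"
      using that app by (auto intro: le_degree)
    moreover from this have "fst w \<le> top_index (fst b)"
      using top_index_greatest[of "fst b" "fst w"] by (meson not_le)
    ultimately show ?thesis
      using that by (cases w) (auto simp: var_less_def order.order_iff_strict)
  qed
  have mem: "appears (lbinom b) ?v" using top_index_nonzero[OF assms(1)] by (simp add: app)
  have "is_leader (lbinom b) ?v" using less mem by (auto simp: is_leader_def)
  moreover have "v = ?v" if "is_leader (lbinom b) v"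
  proof (rule ccontr)
    assume "v \<noteq> ?v"
    then have "var_less v ?v" "var_less ?v v" using that less mem by (auto simp: is_leader_def)
    then show False by (auto simp: var_less_def)
  qed
  ultimately show ?thesis by blast
qed

end

theory Submission
  imports Defs
begin

text \<open>
  A binomial \<open>Y^f - c\<close> is the relation \<open>Y^f = c\<close>, and relations can be multiplied, inverted and
  transformed by \<open>\<sigma>\<close>.  In a proper \<open>\<sigma>\<close>-ideal \<open>I\<close> each support \<open>f\<close> has at most one constant \<open>c\<close>,
  because two of them would put a nonzero constant into \<open>I\<close>.  So the supports of the binomials in
  \<open>I\<close> form a lattice \<open>L\<close>, the constants form a character \<open>\<rho>\<close> on \<open>L\<close>, and if \<open>I\<close> is generated by
  binomials, it is generated by those of \<open>\<rho>\<close> (\<open>proper_binomial_ideal_character\<close>).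

  Conversely, the ideal of a character is governed by the cosets of \<open>L\<close>: every exponent of an
  element \<open>q\<close> of it has a second exponent of \<open>q\<close> in its coset
  (\<open>character_ideal_two_exponents\<close>).  Hence \<open>1\<close> is not in the ideal.  Moreover, the difference of
  the two exponents is a nonzero element of \<open>L\<close>.  If the leading term of every nonzero element of \<open>L\<close>
  is a multiple of the leading term of some generator \<open>g\<close> of \<open>L\<close>, this bounds the degree of \<open>q\<close>
  from below by that of \<open>Y^g - \<rho> g\<close> at a transform of its leader, so \<open>q\<close> is not reduced.  This is
  why the binomials of a sharply reduced Groebner basis form a characteristic set
  (\<open>characteristic_set_lbinom\<close>).

  Such a basis always exists (\<open>sharply_reduced_basis_exists\<close>).  The leading coefficients at a
  position \<open>x^k \<epsilon>_i\<close> form an ideal of the integers, with generator \<open>d\<close> say; for fixed \<open>i\<close> and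
  growing \<open>k\<close> these generators form a chain of divisors, which drops only finitely often.  One
  lattice element for each drop, with its lower coefficients reduced modulo the generators, is
  enough.  In particular every lattice is finitely generated.

  The chain of binomials obtained in this way is coherent, since the remainders that coherence is
  about are again relations of \<open>\<rho>\<close> with a reduced support, and \<open>0\<close> is the only reduced element of
  \<open>L\<close> (\<open>coherent_chain_lbinom\<close>).  For the converse one has to construct the character from a
  coherent chain (\<open>coherent_chain_character\<close>).  At each position where leaders of transforms
  \<open>\<sigma>^t A_i\<close> occur, the transform with the largest \<open>i\<close> is called best.  The best transforms have
  distinct leaders, so they are independent and generate a group of relations in which the leading
  terms are as wanted and no support has two constants (\<open>generated_group_lead\<close>).  Coherence
  expresses each of the other transforms by a best one and transforms with smaller leaders
  (\<open>coherent_relation\<close>); by induction on the leader this group contains all transforms, so it is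
  closed under \<open>\<sigma>\<close>.
\<close>

section \<open>Exponents and leading positions\<close>

lemma expo_0 [simp]: "expo 0 v = 0"
  and expo_add [simp]: "expo (f + g) v = expo f v + expo g v"
  and expo_diff [simp]: "expo (f - g) v = expo f v - expo g v"
  and expo_uminus [simp]: "expo (- f) v = - expo f v"
  by (simp_all add: expo_def)

lemma expo_sum: "expo (\<Sum>a\<in>S. h a) v = (\<Sum>a\<in>S. expo (h a) v)"
  by (induction S rule: infinite_finite_induct) auto

lemma expo_monom_scale:
  "expo (monom a m *s f) (i, k) = (if k < m then 0 else a * expo f (i, k - m))"
  by (simp add: expo_def coeff_monom_mult)

lemma expo_axis: "expo (axis j (monom a l)) (i, k) = (if i = j \<and> k = l then a else 0)"
  by (auto simp: expo_def axis_def)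

lemma shift_monom: "shift f = monom 1 1 *s f"
  by (simp add: shift_def monom_Suc monom_0)

lemma shift_add: "shift (f + g) = shift f + shift g"
  and shift_diff: "shift (f - g) = shift f - shift g"
  and shift_0 [simp]: "shift 0 = 0"
  by (simp_all add: shift_def vec_eq_iff algebra_simps)

lemma shift_power: "(shift ^^ t) f = monom 1 t *s f"
  by (induction t) (auto simp: shift_monom vec_eq_iff mult_monom simp flip: mult.assoc)

lemma var_less_trans: "var_less u v \<Longrightarrow> var_less v w \<Longrightarrow> var_less u w"
  and var_less_irrefl [simp]: "\<not> var_less v v"
  and var_less_linear: "var_less v w \<or> v = w \<or> var_less w v"
  by (auto simp: var_less_def prod_eq_iff)

lemma wf_var_less: "wf {(v, w :: 'n::{finite,linorder} lvar). var_less v w}"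
proof -
  have "wf (Wellfounded.measure (\<lambda>i :: 'n. card {..<i}) <*lex*> {(k, l :: nat). k < l})"
    by (intro wf_lex_prod wf_measure wf_less)
  then show ?thesis by (rule wf_subset) (auto simp: var_less_def intro!: psubset_card_mono)
qed

lemmas var_less_induct = wf_induct_rule[OF wf_var_less, simplified]

definition lead :: "('n::{finite,linorder}) zvec \<Rightarrow> 'n lvar" where
  "lead f = (top_index f, Polynomial.degree (f $ top_index f))"

lemma expo_lead: "f \<noteq> 0 \<Longrightarrow> expo f (lead f) \<noteq> 0"
  using top_index_nonzero[of f] by (simp add: expo_def lead_def)

lemma expo_above_lead: "var_less (lead f) w \<Longrightarrow> expo f w = 0"
  by (auto simp: expo_def lead_def var_less_def top_index_greatest coeff_eq_0)

lemma lead_eqI: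
  assumes "expo f v \<noteq> 0" "\<And>w. var_less v w \<Longrightarrow> expo f w = 0"
  shows "f \<noteq> 0 \<and> lead f = v"
proof -
  have "f \<noteq> 0" using assms(1) by auto
  then show ?thesis
    using assms expo_lead[of f] expo_above_lead[of f v] var_less_linear[of "lead f" v] by metis
qed

lemma LT_lead: "f \<noteq> 0 \<Longrightarrow> LT f = (expo f (lead f), snd (lead f), fst (lead f))"
  by (simp add: LT_eq lead_def expo_def)

lemma normal_iff: "normal f \<longleftrightarrow> f \<noteq> 0 \<and> 0 < expo f (lead f)"
  by (simp add: normal_def lead_def expo_def)

lemma mons_iff: "(a, k, i) \<in> mons f \<longleftrightarrow> a = expo f (i, k) \<and> a \<noteq> 0"
  by (simp add: mons_def expo_def)

lemma mon_less_LT: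
  assumes "f \<noteq> 0" "g \<noteq> 0" "var_less (lead f) (lead g)"
  shows "mon_less (LT f) (LT g)"
  using assms by (auto simp: LT_lead mon_less_def var_less_def)

lemma mon_multiple_iff:
  assumes "a \<noteq> 0"
  shows "mon_multiple (a, k, i) (b, l, j) \<longleftrightarrow> i = j \<and> l \<le> k \<and> b dvd a"
proof
  assume "mon_multiple (a, k, i) (b, l, j)"
  then obtain p where "axis i (monom a k) = p *s axis j (monom b l)"
    by (auto simp: mon_multiple_def mon_vec_def)
  then have eq: "axis i (monom a k) $ i = (p *s axis j (monom b l)) $ i" by simp
  then have ij: "i = j" using assms by (auto simp: axis_def split: if_splits)
  then have "monom a k = monom b l * p" using eq by (simp add: axis_def mult.commute)
  then have "a = poly.coeff (monom b l * p) k" by (metis coeff_monom)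
  then show "i = j \<and> l \<le> k \<and> b dvd a"
    using assms ij by (auto simp: coeff_monom_mult split: if_splits)
next
  assume "i = j \<and> l \<le> k \<and> b dvd a"
  then obtain c where "a = b * c" "i = j" "l \<le> k" by auto
  then have "mon_vec (a, k, i) = monom c (k - l) *s mon_vec (b, l, j)"
    by (auto simp: mon_vec_def vec_eq_iff axis_def mult_monom mult.commute)
  then show "mon_multiple (a, k, i) (b, l, j)" unfolding mon_multiple_def by blast
qed

interpretation zx: module "(*s) :: int poly \<Rightarrow> ('n::finite) zvec \<Rightarrow> 'n zvec"
  by (rule module_zvec)

text \<open>
  A polynomial is built from integer constants by multiplication by \<open>x\<close> and addition, so a
  subgroup closed under the shift is a lattice.
\<close>

lemma zx_subspaceI:
  assumes "0 \<in> S" "\<And>f g. f \<in> S \<Longrightarrow> g \<in> S \<Longrightarrow> f - g \<in> S" "\<And>f. f \<in> S \<Longrightarrow> shift f \<in> S"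
  shows "zx.subspace S"
proof -
  have neg: "- f \<in> S" if "f \<in> S" for f using assms(1,2) that by (metis diff_0)
  have add: "f + g \<in> S" if "f \<in> S" "g \<in> S" for f g
    using assms(2)[of f "- g"] neg that by simp
  have const: "[:a:] *s f \<in> S" if "f \<in> S" for a f
  proof (induction a rule: int_induct[where k = 0])
    case base then show ?case using assms(1) by simp
  next
    case (step1 a)
    have "[:a + 1:] *s f = [:a:] *s f + f" by (simp add: vec_eq_iff smult_add_left)
    then show ?case using add step1 that by simp
  next
    case (step2 a)
    have "[:a - 1:] *s f = [:a:] *s f - f" by (simp add: vec_eq_iff smult_diff_left)
    then show ?case using assms(2) step2 that by simp
  qed
  have "p *s f \<in> S" if "f \<in> S" for p f
  proof (induction p)
    case 0 then show ?case using assms(1) by simp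
  next
    case (pCons a p)
    have "pCons a p *s f = [:a:] *s f + shift (p *s f)"
      by (simp add: vec_eq_iff shift_def)
    then show ?case using add const assms(3) pCons that by simp
  qed
  then show ?thesis using assms(1) add by (auto simp: zx.subspace_def)
qed

lemma subspace_shift: "zx.subspace S \<Longrightarrow> f \<in> S \<Longrightarrow> shift f \<in> S"
  by (simp add: shift_def zx.subspace_scale)

section \<open>Difference ideals and their binomials\<close>

lemma lconst_mult_lmonom: "lconst a * lmonom f = Poly_Mapping.single f a"
  by (simp add: lmonom_def lconst_def mult_single)

lemma laurent_induct [case_names zero single add]:
  fixes p :: "('a::field, 'n::finite) laurent"
  assumes "P 0" "\<And>f a. P (Poly_Mapping.single f a)" "\<And>p q. P p \<Longrightarrow> P q \<Longrightarrow> P (p + q)"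
  shows "P p"
proof -
  have eq: "p = (\<Sum>f\<in>Poly_Mapping.keys p. Poly_Mapping.single f (Poly_Mapping.lookup p f))"
    by (rule poly_mapping_eqI)
      (auto simp: lookup_sum lookup_single when_def in_keys_iff if_distrib cong: if_cong)
  have "P (\<Sum>f\<in>S. Poly_Mapping.single f (Poly_Mapping.lookup p f))" for S
    by (induction S rule: infinite_finite_induct) (use assms in auto)
  then show ?thesis using eq by metis
qed

lemma ideal_0: "sigma_ideal \<sigma> J \<Longrightarrow> 0 \<in> J"
  and ideal_add: "sigma_ideal \<sigma> J \<Longrightarrow> p \<in> J \<Longrightarrow> q \<in> J \<Longrightarrow> p + q \<in> J"
  and ideal_mult: "sigma_ideal \<sigma> J \<Longrightarrow> p \<in> J \<Longrightarrow> r * p \<in> J"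
  and ideal_sigma: "sigma_ideal \<sigma> J \<Longrightarrow> p \<in> J \<Longrightarrow> lsigma \<sigma> p \<in> J"
  by (auto simp: sigma_ideal_def)

lemma ideal_diff:
  assumes "sigma_ideal \<sigma> J" "p \<in> J" "q \<in> J"
  shows "p - q \<in> J"
  using ideal_add[OF assms(1,2), of "(- 1) * q"] ideal_mult[OF assms(1,3), of "- 1"] by simp

text \<open>
  A single term \<open>a Y^f\<close> with \<open>a \<noteq> 0\<close> is invertible.
\<close>

lemma ideal_unit:
  assumes "sigma_ideal \<sigma> J" "Poly_Mapping.single f a \<in> J" "a \<noteq> 0"
  shows "J = UNIV"
proof -
  have "Poly_Mapping.single (- f) (inverse a) * Poly_Mapping.single f a = 1"
    using assms(3) by (simp add: mult_single)
  then have "1 \<in> J" using ideal_mult[OF assms(1,2)] by metis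
  then have "r \<in> J" for r using ideal_mult[OF assms(1), of 1 r] by simp
  then show ?thesis by blast
qed

lemma gen_ideal: "sigma_ideal \<sigma> (gen_sigma_ideal \<sigma> S)"
  unfolding gen_sigma_ideal_def
  by (rule hull_in) (fastforce simp: sigma_ideal_def)

lemma gen_superset: "S \<subseteq> gen_sigma_ideal \<sigma> S"
  unfolding gen_sigma_ideal_def by (rule hull_subset)

lemma gen_least: "sigma_ideal \<sigma> J \<Longrightarrow> S \<subseteq> J \<Longrightarrow> gen_sigma_ideal \<sigma> S \<subseteq> J"
  unfolding gen_sigma_ideal_def by (rule hull_minimal)

lemma gen_unit: "Poly_Mapping.single f a \<in> S \<Longrightarrow> a \<noteq> 0 \<Longrightarrow> gen_sigma_ideal \<sigma> S = UNIV"
  using ideal_unit[OF gen_ideal] gen_superset by blast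

lemma proper_iff: "proper_ideal \<sigma> J \<longleftrightarrow> J \<noteq> UNIV"
  using gen_unit[of 0 1 "{1}" \<sigma>] by (auto simp: proper_ideal_def)

text \<open>
  Quotients of relations hold modulo the ideal of the relations, by the same telescoping as for
  \<open>u / v - c / d\<close> in a field.
\<close>

lemma lbinom_diff:
  assumes "d \<noteq> 0"
  shows "lbinom (f - g, c / d) =
    lmonom (- g) * lbinom (f, c) - (lconst (c / d) * lmonom (- g)) * lbinom (g, d)"
  using assms
  by (simp add: lbinom_def lmonom_def lconst_def mult_single algebra_simps single_diff)

lemma laurent_binomial_lbinom: "laurent_binomial (lbinom b)"
  unfolding laurent_binomial_def
  by (rule exI[of _ 1], rule exI[of _ "fst b"], rule exI[of _ "- snd b"], rule exI[of _ 0])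
    (simp add: lbinom_def lmonom_def lconst_def mult_single single_uminus)

text \<open>
  The relations \<open>Y^f = c\<close> form the group of pairs \<open>(f, c)\<close> that is additive in \<open>f\<close> and
  multiplicative in \<open>c \<noteq> 0\<close>; these are its subgroups.
\<close>

definition binom_group :: "('a::field, 'n::finite) binom set \<Rightarrow> bool" where
  "binom_group G \<longleftrightarrow> (0, 1) \<in> G \<and> (\<forall>(f, c)\<in>G. c \<noteq> 0) \<and>
     (\<forall>(f, c)\<in>G. \<forall>(g, d)\<in>G. (f - g, c / d) \<in> G)"

lemma binom_group_one: "binom_group G \<Longrightarrow> (0, 1) \<in> G"
  and binom_group_nonzero: "binom_group G \<Longrightarrow> (f, c) \<in> G \<Longrightarrow> c \<noteq> 0"
  and binom_group_div: "binom_group G \<Longrightarrow> (f, c) \<in> G \<Longrightarrow> (g, d) \<in> G \<Longrightarrow> (f - g, c / d) \<in> G"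
  by (auto simp: binom_group_def)

lemma binom_group_inverse:
  assumes "binom_group G" "(f, c) \<in> G"
  shows "(- f, inverse c) \<in> G"
  using binom_group_div[OF assms(1) binom_group_one[OF assms(1)] assms(2)]
  by (simp add: divide_inverse)

lemma binom_group_mult:
  assumes "binom_group G" "(f, c) \<in> G" "(g, d) \<in> G"
  shows "(f + g, c * d) \<in> G"
  using binom_group_div[OF assms(1,2) binom_group_inverse[OF assms(1,3)]]
  by (simp add: divide_inverse)

definition ideal_relations :: "('a::field, 'n::finite) laurent set \<Rightarrow> ('a, 'n) binom set" where
  "ideal_relations J = {b. snd b \<noteq> 0 \<and> lbinom b \<in> J}"

lemma binom_group_ideal_relations:
  assumes "sigma_ideal \<sigma> J"
  shows "binom_group (ideal_relations J)"
proof -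
  have "lbinom (0, 1) \<in> J"
    using ideal_0[OF assms] by (simp add: lbinom_def lmonom_def lconst_def)
  then show ?thesis
    by (auto simp: binom_group_def ideal_relations_def lbinom_diff
        intro!: ideal_diff[OF assms] ideal_mult[OF assms])
qed

text \<open>
  If two constants \<open>c\<close> and \<open>d\<close> belong to one support, then \<open>(0, c / d)\<close> is in the group; so a
  group in which the support \<open>0\<close> only has the constant \<open>1\<close> is the graph of a character.
\<close>

lemma character_of_group:
  assumes G: "binom_group G" "sigma_binom \<sigma> ` G \<subseteq> G" and unique: "\<And>c. (0, c) \<in> G \<Longrightarrow> c = 1"
  obtains \<rho> where "character_on \<sigma> (fst ` G) \<rho>" "\<And>f c. (f, c) \<in> G \<Longrightarrow> \<rho> f = c"
    "zx.subspace (fst ` G)"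
proof -
  define \<rho> where "\<rho> f = (THE c. (f, c) \<in> G)" for f
  have rho: "\<rho> f = c" if "(f, c) \<in> G" for f c
    unfolding \<rho>_def
  proof (rule the_equality)
    fix d assume "(f, d) \<in> G"
    then have "d / c = 1"
      using unique[of "d / c"] binom_group_div[OF G(1) \<open>(f, d) \<in> G\<close> that] by simp
    then show "d = c" by (metis divide_eq_1_iff)
  qed (rule that)
  have sig: "(shift f, \<sigma> c) \<in> G" if "(f, c) \<in> G" for f c
    using G(2) that by (auto simp: sigma_binom_def)
  have "character_on \<sigma> (fst ` G) \<rho>"
    unfolding character_on_def
    using binom_group_nonzero[OF G(1)] binom_group_mult[OF G(1)] sig by (auto simp: rho)
  moreover have "zx.subspace (fst ` G)"
    by (rule zx_subspaceI)
      (use binom_group_one[OF G(1)] binom_group_div[OF G(1)] sig in \<open>force+\<close>)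
  ultimately show thesis using that rho by blast
qed

definition character_graph ::
    "('n::finite) zvec set \<Rightarrow> ('n zvec \<Rightarrow> 'a) \<Rightarrow> ('a::field, 'n) binom set" where
  "character_graph L \<rho> = {(f, \<rho> f) | f. f \<in> L}"

lemma character_0:
  assumes "character_on \<sigma> L \<rho>" "0 \<in> L"
  shows "\<rho> 0 = 1"
proof -
  have "\<rho> (0 + 0) = \<rho> 0 * \<rho> 0" "\<rho> 0 \<noteq> 0"
    using assms unfolding character_on_def by blast+
  then show ?thesis by simp
qed

lemma binom_group_character_graph:
  assumes "character_on \<sigma> L \<rho>" "zx.subspace L"
  shows "binom_group (character_graph L \<rho>)" "sigma_binom \<sigma> ` character_graph L \<rho> \<subseteq> character_graph L \<rho>"
proof -
  have "\<rho> (f - g) = \<rho> f / \<rho> g" if "f \<in> L" "g \<in> L" for f g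
  proof -
    have "\<rho> ((f - g) + g) = \<rho> (f - g) * \<rho> g" "\<rho> g \<noteq> 0"
      using assms(1) zx.subspace_diff[OF assms(2) that] that unfolding character_on_def by blast+
    then show ?thesis by (simp add: field_simps)
  qed
  then show "binom_group (character_graph L \<rho>)"
    using assms character_0[OF assms(1)] zx.subspace_0[OF assms(2)]
    by (auto simp: binom_group_def character_graph_def zx.subspace_diff character_on_def)
  show "sigma_binom \<sigma> ` character_graph L \<rho> \<subseteq> character_graph L \<rho>"
    using assms by (auto simp: character_graph_def sigma_binom_def character_on_def subspace_shift)
qed

lemma character_ideal_altdef:
  "character_ideal \<sigma> L \<rho> = gen_sigma_ideal \<sigma> (lbinom ` character_graph L \<rho>)"
proof -
  have "{lmonom f - lconst (\<rho> f) | f. f \<in> L} = lbinom ` character_graph L \<rho>"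
    by (auto simp: character_graph_def lbinom_def image_def)
  then show ?thesis by (simp add: character_ideal_def)
qed

context difference_field
begin

lemma sigma_0: "\<sigma> 0 = 0"
  by (simp add: sigma_eq_0_iff)

lemma sigma_1: "\<sigma> 1 = 1"
  using sigma_mult[of 1 1] sigma_eq_0_iff[of 1] by simp

lemma sigma_divide: "\<sigma> (a / b) = \<sigma> a / \<sigma> b"
proof (cases "b = 0")
  case False
  have "\<sigma> a = \<sigma> (a / b) * \<sigma> b" using False by (simp flip: sigma_mult)
  then show ?thesis using False by (simp add: sigma_eq_0_iff)
qed (simp add: sigma_0)

lemma lsigma_single: "lsigma \<sigma> (Poly_Mapping.single f a) = Poly_Mapping.single (shift f) (\<sigma> a)"
  by (simp add: lsigma_def sigma_0)

lemma lsigma_add: "lsigma \<sigma> (p + q) = lsigma \<sigma> p + lsigma \<sigma> q"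
  unfolding lsigma_def
  by (rule setsum_keys_plus_distrib[where f = "\<lambda>f a. Poly_Mapping.single (shift f) (\<sigma> a)"])
    (simp_all add: sigma_0 sigma_add single_add)

lemma lsigma_lbinom: "lsigma \<sigma> (lbinom b) = lbinom (sigma_binom \<sigma> b)"
proof -
  have "lsigma \<sigma> (lbinom b) + lsigma \<sigma> (lconst (snd b)) = lsigma \<sigma> (lmonom (fst b))"
    by (simp add: lbinom_def flip: lsigma_add)
  then show ?thesis
    by (simp add: lbinom_def lmonom_def lconst_def sigma_binom_def lsigma_single sigma_1
        algebra_simps)
qed

lemma sigma_ideal_relations:
  assumes "sigma_ideal \<sigma> J"
  shows "sigma_binom \<sigma> ` ideal_relations J \<subseteq> ideal_relations J"
proof -
  have "lbinom (sigma_binom \<sigma> b) \<in> J" if "lbinom b \<in> J" for b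
    using ideal_sigma[OF assms that] by (simp add: lsigma_lbinom)
  then show ?thesis
    by (auto simp: ideal_relations_def sigma_eq_0_iff sigma_binom_def)
qed

text \<open>
  The supports on which the relation of \<open>\<rho>\<close> holds modulo the generated ideal form a lattice, and it
  contains the generators.
\<close>

lemma gen_eq_character_ideal:
  assumes rho: "character_on \<sigma> (zx_span (fst ` B)) \<rho>" "\<And>b. b \<in> B \<Longrightarrow> \<rho> (fst b) = snd b"
  shows "gen_sigma_ideal \<sigma> (lbinom ` B) = character_ideal \<sigma> (zx_span (fst ` B)) \<rho>"
proof -
  let ?L = "zx_span (fst ` B)" and ?J = "gen_sigma_ideal \<sigma> (lbinom ` B)"
  define G where "G = character_graph ?L \<rho> \<inter> ideal_relations ?J"
  note graph = binom_group_character_graph[OF rho(1) zx.subspace_span]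
  note rel = binom_group_ideal_relations[OF gen_ideal]
    sigma_ideal_relations[OF gen_ideal]
  have B: "B \<subseteq> character_graph ?L \<rho>"
  proof
    fix b assume b: "b \<in> B"
    then have "b = (fst b, \<rho> (fst b))" "fst b \<in> ?L"
      using rho(2) by (simp_all add: zx.span_base)
    then show "b \<in> character_graph ?L \<rho>" unfolding character_graph_def by blast
  qed
  have "zx.subspace (fst ` G)"
  proof (rule zx_subspaceI)
    show "0 \<in> fst ` G"
      using binom_group_one[OF graph(1)] binom_group_one[OF rel(1)]
      unfolding G_def by (metis IntI fst_conv imageI)
    show "f - g \<in> fst ` G" if fg: "f \<in> fst ` G" "g \<in> fst ` G" for f g
    proof -
      obtain c d where "(f, c) \<in> G" "(g, d) \<in> G" using fg by auto
      then have "(f - g, c / d) \<in> G"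
        using binom_group_div[OF graph(1)] binom_group_div[OF rel(1)] by (auto simp: G_def)
      then show ?thesis by (metis fst_conv imageI)
    qed
    show "shift f \<in> fst ` G" if f: "f \<in> fst ` G" for f
    proof -
      obtain b where "b \<in> G" "f = fst b" using f by auto
      then have "sigma_binom \<sigma> b \<in> G" using graph(2) rel(2) by (auto simp: G_def)
      then show ?thesis using \<open>f = fst b\<close> by (metis fst_conv imageI sigma_binom_def)
    qed
  qed
  moreover have "fst ` B \<subseteq> fst ` G"
  proof (rule image_mono, rule subsetI)
    fix b assume b: "b \<in> B"
    then have "b \<in> character_graph ?L \<rho>" using B by blast
    moreover have "snd b \<noteq> 0"
      using binom_group_nonzero[OF graph(1), of "fst b" "snd b"] calculation by simp
    moreover have "lbinom b \<in> ?J" using b gen_superset[of "lbinom ` B" \<sigma>] by blast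
    ultimately show "b \<in> G" by (simp add: G_def ideal_relations_def)
  qed
  ultimately have "?L \<subseteq> fst ` G" by (rule zx.span_minimal[rotated])
  then have "lbinom ` character_graph ?L \<rho> \<subseteq> ?J"
    by (auto simp: G_def character_graph_def ideal_relations_def)
  then have "character_ideal \<sigma> ?L \<rho> \<subseteq> ?J"
    unfolding character_ideal_altdef by (rule gen_least[OF gen_ideal])
  moreover have "?J \<subseteq> character_ideal \<sigma> ?L \<rho>"
    unfolding character_ideal_altdef using B gen_superset by (intro gen_least[OF gen_ideal]) blast
  ultimately show ?thesis by blast
qed

text \<open>\<open>Y^0 - c\<close> is the constant \<open>1 - c\<close>, a unit unless \<open>c = 1\<close>.\<close>

lemma ideal_relations_functional:
  assumes "sigma_ideal \<sigma> J" "J \<noteq> UNIV" "(0, c) \<in> ideal_relations J"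
  shows "c = 1"
proof (rule ccontr)
  assume "c \<noteq> 1"
  moreover have "Poly_Mapping.single 0 (1 - c) \<in> J"
    using assms(3) by (simp add: ideal_relations_def lbinom_def lmonom_def lconst_def single_diff)
  ultimately show False using ideal_unit[OF assms(1), of 0 "1 - c"] assms(2) by simp
qed

text \<open>
  A generator \<open>a Y^g + b Y^h\<close> is zero or a unit, or \<open>a Y^h\<close> times the binomial of the relation
  \<open>Y^(g - h) = - b / a\<close>.  In a proper ideal there are no units, so the relations account for all
  generators.
\<close>

lemma proper_binomial_ideal_character:
  assumes "laurent_binomial_ideal \<sigma> J" "J \<noteq> UNIV"
  obtains L \<rho> where "zx.subspace L" "character_on \<sigma> L \<rho>" "J = character_ideal \<sigma> L \<rho>"
    "\<And>b. lbinom b \<in> J \<Longrightarrow> snd b \<noteq> 0 \<Longrightarrow> fst b \<in> L \<and> \<rho> (fst b) = snd b"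
proof -
  obtain S where S: "\<And>p. p \<in> S \<Longrightarrow> laurent_binomial p" "J = gen_sigma_ideal \<sigma> S"
    using assms(1) by (auto simp: laurent_binomial_ideal_def)
  have J: "sigma_ideal \<sigma> J" using S(2) gen_ideal by simp
  let ?G = "ideal_relations J"
  obtain \<rho> where rho: "character_on \<sigma> (fst ` ?G) \<rho>" "\<And>f c. (f, c) \<in> ?G \<Longrightarrow> \<rho> f = c"
      "zx.subspace (fst ` ?G)"
    using character_of_group[OF binom_group_ideal_relations[OF J] sigma_ideal_relations[OF J]
        ideal_relations_functional[OF J assms(2)]] by blast
  have graph: "character_graph (fst ` ?G) \<rho> = ?G"
  proof (intro equalityI subsetI)
    show "b \<in> ?G" if "b \<in> character_graph (fst ` ?G) \<rho>" for b
      using that rho(2) unfolding character_graph_def by fastforce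
    show "b \<in> character_graph (fst ` ?G) \<rho>" if "b \<in> ?G" for b
      using that rho(2)[of "fst b" "snd b"] unfolding character_graph_def
      by (intro CollectI exI[of _ "fst b"]) auto
  qed
  have "S \<subseteq> gen_sigma_ideal \<sigma> (lbinom ` ?G)"
  proof
    fix p assume "p \<in> S"
    then obtain a g b h where "p = lconst a * lmonom g + lconst b * lmonom h"
      using S(1) unfolding laurent_binomial_def by blast
    then have p: "p = Poly_Mapping.single g a + Poly_Mapping.single h b"
      by (simp add: lconst_mult_lmonom)
    have pJ: "p \<in> J" using \<open>p \<in> S\<close> S(2) gen_superset by blast
    consider "p = 0" | "a \<noteq> 0" "b \<noteq> 0"
    proof (cases "g = h \<or> a = 0 \<or> b = 0")
      case True
      then obtain f c where fc: "p = Poly_Mapping.single f c"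
        using p by (metis add_0 add_0_right single_add single_zero)
      then have "c = 0" using ideal_unit[OF J, of f c] assms(2) pJ by blast
      then show ?thesis using that(1) fc by simp
    qed (use that in auto)
    then show "p \<in> gen_sigma_ideal \<sigma> (lbinom ` ?G)"
    proof cases
      case 1
      then show ?thesis using ideal_0[OF gen_ideal] by simp
    next
      case 2
      have eq: "p = Poly_Mapping.single h a * lbinom (g - h, - b / a)"
        "Poly_Mapping.single (- h) (inverse a) * p = lbinom (g - h, - b / a)"
        using 2
        by (simp_all add: p lbinom_def lmonom_def lconst_def mult_single
            algebra_simps single_uminus) (simp add: divide_inverse)
      have "(g - h, - b / a) \<in> ?G"
        using 2 ideal_mult[OF J pJ, of "Poly_Mapping.single (- h) (inverse a)"]
        unfolding eq(2) by (simp add: ideal_relations_def)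
      then have "lbinom (g - h, - b / a) \<in> gen_sigma_ideal \<sigma> (lbinom ` ?G)"
        using gen_superset by blast
      then show ?thesis using ideal_mult[OF gen_ideal] eq(1) by metis
    qed
  qed
  then have "J \<subseteq> gen_sigma_ideal \<sigma> (lbinom ` ?G)" using S(2) gen_least[OF gen_ideal] by simp
  moreover have "gen_sigma_ideal \<sigma> (lbinom ` ?G) \<subseteq> J"
    by (rule gen_least[OF J]) (auto simp: ideal_relations_def)
  ultimately have "J = character_ideal \<sigma> (fst ` ?G) \<rho>"
    unfolding character_ideal_altdef graph by blast
  moreover have "fst b \<in> fst ` ?G \<and> \<rho> (fst b) = snd b" if "lbinom b \<in> J" "snd b \<noteq> 0" for b
    using that rho(2)[of "fst b" "snd b"] by (auto simp: ideal_relations_def)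
  ultimately show thesis using that rho by blast
qed

lemma character_on_subset:
  "character_on \<sigma> L \<rho> \<Longrightarrow> L' \<subseteq> L \<Longrightarrow> character_on \<sigma> L' \<rho>"
  unfolding character_on_def by blast

text \<open>
  Weighting the exponents \<open>g\<close> of a coset \<open>f + L\<close> by \<open>\<rho> (g - f)\<close> gives a linear functional that
  annihilates the ideal of the character.  Such a functional cannot vanish on an element having a
  single exponent in the coset.
\<close>

lemma character_ideal_two_exponents:
  assumes L: "zx.subspace L" and rho: "character_on \<sigma> L \<rho>"
    and q: "q \<in> character_ideal \<sigma> L \<rho>" and f: "f \<in> Poly_Mapping.keys q"
  obtains g where "g \<in> Poly_Mapping.keys q" "g \<noteq> f" "g - f \<in> L"
proof -
  define w where "w g = (if g - f \<in> L then \<rho> (g - f) else 0)" for g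
  define \<phi> where "\<phi> p = (\<Sum>g\<in>Poly_Mapping.keys p. w g * Poly_Mapping.lookup p g)" for p
  have phi_add: "\<phi> (p + r) = \<phi> p + \<phi> r" for p r
    unfolding \<phi>_def
    by (rule setsum_keys_plus_distrib[where f = "\<lambda>g a. w g * a"]) (simp_all add: algebra_simps)
  have phi_0: "\<phi> 0 = 0" by (simp add: \<phi>_def)
  have phi_single: "\<phi> (Poly_Mapping.single g a) = w g * a" for g a
    by (simp add: \<phi>_def)
  have w_add: "w (g + h) = w g * \<rho> h" if "h \<in> L" for g h
  proof -
    have "g + h - f \<in> L \<longleftrightarrow> g - f \<in> L"
      using zx.subspace_add[OF L _ that, of "g - f"] zx.subspace_diff[OF L _ that, of "g + h - f"]
      by (auto simp: algebra_simps)
    moreover have "\<rho> (g - f + h) = \<rho> (g - f) * \<rho> h" if "g - f \<in> L"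
      using rho that \<open>h \<in> L\<close> unfolding character_on_def by blast
    ultimately show ?thesis by (auto simp: w_def algebra_simps)
  qed
  \<comment> \<open>The plain ideal spanned by the binomials of the character is already closed under \<open>\<sigma>\<close>.\<close>
  define K where "K = {p. \<exists>ps. p = sum_list ps \<and>
    (\<forall>r\<in>set ps. \<exists>g a h. h \<in> L \<and> r = Poly_Mapping.single g a * lbinom (h, \<rho> h))}"
  let ?gen = "\<lambda>r. \<exists>g a h. h \<in> L \<and> r = Poly_Mapping.single g a * lbinom (h, \<rho> h)"
  have K_gen: "r \<in> K" if "?gen r" for r
    using that unfolding K_def by (intro CollectI exI[of _ "[r]"]) simp
  have K_add: "p + r \<in> K" if "p \<in> K" "r \<in> K" for p r
  proof -
    obtain ps rs where "p = sum_list ps" "\<forall>r\<in>set ps. ?gen r" "r = sum_list rs" "\<forall>r\<in>set rs. ?gen r"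
      using \<open>p \<in> K\<close> \<open>r \<in> K\<close> by (auto simp: K_def)
    then show ?thesis unfolding K_def by (intro CollectI exI[of _ "ps @ rs"]) auto
  qed
  have K_0: "0 \<in> K" unfolding K_def by (intro CollectI exI[of _ "[]"]) simp
  have K_induct: "P p" if "p \<in> K" "P 0" "\<And>p r. P p \<Longrightarrow> P r \<Longrightarrow> P (p + r)"
      "\<And>g a h. h \<in> L \<Longrightarrow> P (Poly_Mapping.single g a * lbinom (h, \<rho> h))" for P p
  proof -
    obtain ps where "p = sum_list ps" "\<forall>r\<in>set ps. ?gen r" using \<open>p \<in> K\<close> by (auto simp: K_def)
    then show ?thesis using that(2-) by (induction ps arbitrary: p) auto
  qed
  have "sigma_ideal \<sigma> K"
    unfolding sigma_ideal_def
  proof (intro conjI allI ballI subsetI)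
    show "r * p \<in> K" if "p \<in> K" for r p
    proof (rule K_induct[OF that])
      show "r * (Poly_Mapping.single g a * lbinom (h, \<rho> h)) \<in> K" if h: "h \<in> L" for g a h
      proof (induction r rule: laurent_induct)
        case (single k b)
        have "Poly_Mapping.single k b * (Poly_Mapping.single g a * lbinom (h, \<rho> h)) =
            Poly_Mapping.single (k + g) (b * a) * lbinom (h, \<rho> h)"
          by (simp add: mult_single flip: mult.assoc)
        then show ?case using K_gen h by metis
      qed (simp_all add: K_0 K_add distrib_right)
    qed (simp_all add: K_0 K_add distrib_left)
    show "p \<in> K" if "p \<in> lsigma \<sigma> ` K" for p
    proof -
      obtain r where r: "r \<in> K" "p = lsigma \<sigma> r" using \<open>p \<in> lsigma \<sigma> ` K\<close> by blast
      have lsig_gen: "lsigma \<sigma> (Poly_Mapping.single g a * lbinom (h, \<rho> h)) =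
          Poly_Mapping.single (shift g) (\<sigma> a) * lbinom (shift h, \<rho> (shift h))" if "h \<in> L" for g a h
      proof -
        have "Poly_Mapping.single g a * lbinom (h, \<rho> h) =
            Poly_Mapping.single (g + h) a + Poly_Mapping.single g (- a * \<rho> h)" (is "_ = ?r")
          by (simp add: lbinom_def lmonom_def lconst_def algebra_simps mult_single single_uminus)
        moreover have "\<sigma> (- a) = - \<sigma> a" using sigma_add[of a "- a"] sigma_0
          by (simp add: eq_neg_iff_add_eq_0 add.commute)
        moreover have "\<rho> (shift h) = \<sigma> (\<rho> h)" using rho that by (simp add: character_on_def)
        moreover have "lsigma \<sigma> ?r = Poly_Mapping.single (shift g + shift h) (\<sigma> a) +
            Poly_Mapping.single (shift g) (\<sigma> (- a) * \<sigma> (\<rho> h))"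
          unfolding lsigma_add lsigma_single shift_add sigma_mult by simp
        ultimately show ?thesis
          by (simp add: lbinom_def lmonom_def lconst_def algebra_simps mult_single single_uminus)
      qed
      have "lsigma \<sigma> r \<in> K"
      proof (rule K_induct[OF r(1)])
        show "lsigma \<sigma> 0 \<in> K" using K_0 by (simp add: lsigma_def)
        show "lsigma \<sigma> (p + r) \<in> K" if "lsigma \<sigma> p \<in> K" "lsigma \<sigma> r \<in> K" for p r
          using that by (simp add: lsigma_add K_add)
        show "lsigma \<sigma> (Poly_Mapping.single g a * lbinom (h, \<rho> h)) \<in> K" if "h \<in> L" for g a h
          using lsig_gen[OF that] subspace_shift[OF L that] K_gen by metis
      qed
      then show ?thesis using r by simp
    qed
  qed (simp_all add: K_0 K_add)
  moreover have "lbinom (h, \<rho> h) \<in> K" if "h \<in> L" for h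
    using K_gen[of "Poly_Mapping.single 0 1 * lbinom (h, \<rho> h)"] that by fastforce
  ultimately have "character_ideal \<sigma> L \<rho> \<subseteq> K"
    unfolding character_ideal_altdef by (intro gen_least) (auto simp: character_graph_def)
  then have "q \<in> K" using q by blast
  then have "\<phi> q = 0"
  proof (rule K_induct)
    show "\<phi> (Poly_Mapping.single g a * lbinom (h, \<rho> h)) = 0" if "h \<in> L" for g a h
    proof -
      have "Poly_Mapping.single g a * lbinom (h, \<rho> h) =
          Poly_Mapping.single (g + h) a + Poly_Mapping.single g (- a * \<rho> h)"
        by (simp add: lbinom_def lmonom_def lconst_def algebra_simps mult_single single_uminus)
      then show ?thesis by (simp add: phi_add phi_single w_add[OF that])
    qed
  qed (simp_all add: phi_add phi_0)
  moreover have "\<phi> q = w f * Poly_Mapping.lookup q f +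
      (\<Sum>g\<in>Poly_Mapping.keys q - {f}. w g * Poly_Mapping.lookup q g)"
    using f by (simp add: \<phi>_def sum.remove)
  moreover have "w f * Poly_Mapping.lookup q f \<noteq> 0"
    using f character_0[OF rho] zx.subspace_0[OF L] by (simp add: w_def in_keys_iff)
  ultimately have "(\<Sum>g\<in>Poly_Mapping.keys q - {f}. w g * Poly_Mapping.lookup q g) \<noteq> 0"
    by auto
  then obtain g where "g \<in> Poly_Mapping.keys q - {f}" "w g \<noteq> 0"
    by (metis (no_types, lifting) mult_zero_left sum.neutral)
  then show thesis using that by (auto simp: w_def split: if_splits)
qed

lemma character_ideal_proper:
  assumes "zx.subspace L" "character_on \<sigma> L \<rho>"
  shows "character_ideal \<sigma> L \<rho> \<noteq> UNIV"
proof
  assume "character_ideal \<sigma> L \<rho> = UNIV"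
  then have "1 \<in> character_ideal \<sigma> L \<rho>" by simp
  moreover have "0 \<in> Poly_Mapping.keys (1 :: ('a, 'b) laurent)" by (simp add: in_keys_iff)
  ultimately show False
    by (rule character_ideal_two_exponents[OF assms]) simp
qed

end

section \<open>Reduced exponents, ascending chains and characteristic sets\<close>

text \<open>
  This is \<open>reduced_wrt\<close> for the binomials with supports \<open>f\<close> and \<open>g\<close>, which does not depend on the
  constants.
\<close>

definition exp_reduced :: "('n::{finite,linorder}) zvec \<Rightarrow> 'n zvec \<Rightarrow> bool" where
  "exp_reduced f g \<longleftrightarrow> (\<forall>k\<ge>snd (lead g). \<bar>expo f (fst (lead g), k)\<bar> < \<bar>expo g (lead g)\<bar>)"

text \<open>
  On supports, this is the condition that binomials form an ascending chain.  Of the two ways to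
  have higher rank only the higher leader remains: with equal leaders, a larger degree contradicts
  reducedness.
\<close>

definition reduced_chain :: "('n::{finite,linorder}) zvec list \<Rightarrow> bool" where
  "reduced_chain = sorted_wrt (\<lambda>f g. var_less (lead f) (lead g) \<and> exp_reduced g f)"

text \<open>
  The property of a Groebner basis on which everything rests: divisibility by a single leading
  term, not just membership in the module that the leading terms generate.
\<close>

definition leading_multiples :: "('n::{finite,linorder}) zvec set \<Rightarrow> 'n zvec set \<Rightarrow> bool" where
  "leading_multiples F L \<longleftrightarrow> (\<forall>h\<in>L - {0}. \<exists>f\<in>F - {0}. mon_multiple (LT h) (LT f))"

lemma leading_multiplesE:
  assumes "leading_multiples F L" "h \<in> L" "h \<noteq> 0"
  obtains f where "f \<in> F" "f \<noteq> 0" "fst (lead f) = fst (lead h)" "snd (lead f) \<le> snd (lead h)"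
    "expo f (lead f) dvd expo h (lead h)"
proof -
  obtain f where f: "f \<in> F" "f \<noteq> 0" "mon_multiple (LT h) (LT f)"
    using assms by (auto simp: leading_multiples_def)
  then show thesis
    using that[of f] assms(3) expo_lead[OF assms(3)] by (auto simp: LT_lead mon_multiple_iff)
qed

lemma is_leader_lead:
  "fst b \<noteq> 0 \<Longrightarrow> snd b \<noteq> 0 \<Longrightarrow> is_leader (lbinom b) v \<longleftrightarrow> v = lead (fst b)"
  by (simp add: is_leader_lbinom lead_def)

lemma reduced_wrt_lbinom:
  assumes "fst b \<noteq> 0" "snd b \<noteq> 0"
  shows "reduced_wrt q (lbinom b) \<longleftrightarrow>
    (\<forall>k\<ge>snd (lead (fst b)). absdeg q (fst (lead (fst b)), k) < \<bar>expo (fst b) (lead (fst b))\<bar>)"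
    (is "_ \<longleftrightarrow> ?r")
proof -
  have "reduced_wrt q (lbinom b) \<longleftrightarrow>
      (\<forall>l. absdeg q (fst (lead (fst b)), snd (lead (fst b)) + l) < \<bar>expo (fst b) (lead (fst b))\<bar>)"
    by (cases "lead (fst b)")
      (simp add: reduced_wrt_def is_leader_lead[OF assms] absdeg_lbinom[OF assms(2)])
  then show ?thesis by (metis le_add1 le_add_diff_inverse)
qed

lemma reduced_wrt_lbinom_lbinom:
  "fst b \<noteq> 0 \<Longrightarrow> snd b \<noteq> 0 \<Longrightarrow> snd a \<noteq> 0 \<Longrightarrow>
    reduced_wrt (lbinom a) (lbinom b) \<longleftrightarrow> exp_reduced (fst a) (fst b)"
  by (simp add: reduced_wrt_lbinom absdeg_lbinom exp_reduced_def)

lemma ascending_chain_lbinom: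
  assumes "\<And>b. b \<in> set bs \<Longrightarrow> fst b \<noteq> 0 \<and> snd b \<noteq> 0"
  shows "ascending_chain (map lbinom bs) \<longleftrightarrow> reduced_chain (map fst bs)"
proof -
  have eq: "higher_rank (lbinom a) (lbinom b) \<and> reduced_wrt (lbinom a) (lbinom b) \<longleftrightarrow>
      var_less (lead (fst b)) (lead (fst a)) \<and> exp_reduced (fst a) (fst b)"
    if "a \<in> set bs" "b \<in> set bs" for a b
  proof -
    note nz = assms[OF that(1), THEN conjunct1] assms[OF that(1), THEN conjunct2]
      assms[OF that(2), THEN conjunct1] assms[OF that(2), THEN conjunct2]
    have "\<not> \<bar>expo (fst b) (lead (fst b))\<bar> < \<bar>expo (fst a) (lead (fst b))\<bar>"
      if "exp_reduced (fst a) (fst b)"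
      using that[unfolded exp_reduced_def, rule_format, of "snd (lead (fst b))"] by simp
    then show ?thesis
      unfolding higher_rank_def reduced_wrt_lbinom_lbinom[OF nz(3,4,2)]
        is_leader_lead[OF nz(1,2)] is_leader_lead[OF nz(3,4)]
        absdeg_lbinom[OF nz(2)] absdeg_lbinom[OF nz(4)]
      by auto
  qed
  have "0 \<notin> set (map lbinom bs)"
    using assms by (auto simp: lbinom_eq_0_iff dest!: sym[of 0])
  then have "ascending_chain (map lbinom bs) \<longleftrightarrow>
      sorted_wrt (\<lambda>b a. higher_rank (lbinom a) (lbinom b) \<and> reduced_wrt (lbinom a) (lbinom b)) bs"
    by (simp add: ascending_chain_def sorted_wrt_map)
  also have "\<dots> \<longleftrightarrow>
      sorted_wrt (\<lambda>b a. var_less (lead (fst b)) (lead (fst a)) \<and> exp_reduced (fst a) (fst b)) bs"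
    by (intro iffI; erule sorted_wrt_mono_rel[rotated]) (use eq in blast)+
  finally show ?thesis by (simp add: reduced_chain_def sorted_wrt_map)
qed

text \<open>
  The initial of a normal binomial is a monomial, and so are its transforms.  They are units, so the
  ideals in the definition contain \<open>1\<close>, which involves no variable.
\<close>

lemma (in difference_field) regular_chain_lbinom:
  assumes "\<And>b. b \<in> set bs \<Longrightarrow> normal_binom b"
  shows "regular_chain \<sigma> (map lbinom bs)"
  unfolding regular_chain_def
proof (intro allI impI)
  fix i assume i: "i < length (map lbinom bs)"
  obtain f c where fc: "bs ! i = (f, c)" by fastforce
  then have nf: "f \<noteq> 0" "0 < expo f (lead f)" and c: "c \<noteq> 0"
    using assms[OF nth_mem, of i] i by (auto simp: normal_binom_def normal_iff)
  obtain l r where lr: "lead f = (l, r)" by fastforce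
  let ?p = "map lbinom bs ! i"
  have p: "?p = lbinom (f, c)" using i fc by simp
  have keys: "Poly_Mapping.keys ?p = {f, 0}" using keys_lbinom[of "(f, c)"] nf c p by simp
  have "Max ((\<lambda>f. expo f (l, r)) ` Poly_Mapping.keys ?p) = expo f (l, r)"
    unfolding keys using nf(2) lr by simp
  moreover have "{g \<in> Poly_Mapping.keys ?p. expo g (l, r) = expo f (l, r)} = {f}"
    unfolding keys using nf(2) lr by auto
  moreover have "Poly_Mapping.lookup ?p f = 1"
    using nf by (simp add: p lbinom_def lmonom_def lconst_def lookup_minus lookup_single)
  ultimately obtain g where init: "initial_wrt ?p (l, r) = Poly_Mapping.single g 1"
    by (simp add: initial_wrt_def Let_def)
  have "(lsigma \<sigma> ^^ j) (Poly_Mapping.single g 1) = Poly_Mapping.single ((shift ^^ j) g) 1" for j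
    by (induction j) (simp_all add: lsigma_single sigma_1)
  then have "gen_sigma_ideal \<sigma> (insert ((lsigma \<sigma> ^^ j) (initial_wrt ?p (l, r)))
      (set (take i (map lbinom bs)))) = UNIV" for j
    unfolding init by (intro gen_unit[of _ 1]) auto
  moreover have "is_leader ?p (l, r)"
    using is_leader_lead[of "(f, c)"] nf c lr by (simp add: p)
  moreover have "Poly_Mapping.keys (1 :: ('a, 'b) laurent) = {0}" by simp
  ultimately show "\<exists>l r. is_leader ?p (l, r) \<and> (\<forall>j. \<exists>q\<in>gen_sigma_ideal \<sigma>
      (insert ((lsigma \<sigma> ^^ j) (initial_wrt ?p (l, r))) (set (take i (map lbinom bs)))).
        q \<noteq> 0 \<and> difference_polynomial q \<and> (\<forall>f\<in>Poly_Mapping.keys q. \<forall>k. expo f (l, r + k) = 0))"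
    by (intro exI[of _ l] exI[of _ r] conjI allI bexI[of _ 1])
      (simp_all add: difference_polynomial_def)
qed

lemma absdeg_ge:
  assumes "f \<in> Poly_Mapping.keys q" "g \<in> Poly_Mapping.keys q"
  shows "\<bar>expo (f - g) v\<bar> \<le> absdeg q v"
proof -
  let ?E = "(\<lambda>f. expo f v) ` Poly_Mapping.keys q"
  have "expo f v \<le> Max ?E" "expo g v \<le> Max ?E" "Min ?E \<le> expo f v" "Min ?E \<le> expo g v"
    using assms by auto
  moreover have "q \<noteq> 0" using assms by auto
  ultimately show ?thesis by (simp add: absdeg_def)
qed

text \<open>
  A nonzero element of the ideal has two exponents in one coset of \<open>L\<close>.  The leading term of their
  difference is a multiple of that of a chain element, which makes the degree in a transform of its
  leader too large for a reduced element.
\<close>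

lemma (in difference_field) characteristic_set_lbinom:
  assumes L: "zx.subspace L" and rho: "character_on \<sigma> L \<rho>" and J: "J = character_ideal \<sigma> L \<rho>"
    and bs: "\<And>b. b \<in> set bs \<Longrightarrow> fst b \<noteq> 0 \<and> snd b \<noteq> 0 \<and> lbinom b \<in> J"
    and chain: "reduced_chain (map fst bs)"
    and mult: "leading_multiples (fst ` set bs) L"
  shows "characteristic_set J (map lbinom bs)"
proof -
  have "\<exists>b\<in>set bs. \<not> reduced_wrt q (lbinom b)" if q: "q \<in> J" "q \<noteq> 0" for q
  proof -
    obtain f where f: "f \<in> Poly_Mapping.keys q" using q(2) by (metis all_not_in_conv keys_eq_empty)
    obtain g where g: "g \<in> Poly_Mapping.keys q" "g \<noteq> f" "g - f \<in> L"
      using character_ideal_two_exponents[OF L rho _ f] q(1) J by blast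
    then have nz: "g - f \<noteq> 0" by simp
    obtain h where h: "h \<in> fst ` set bs" "h \<noteq> 0" "fst (lead h) = fst (lead (g - f))"
      "snd (lead h) \<le> snd (lead (g - f))" "expo h (lead h) dvd expo (g - f) (lead (g - f))"
      by (rule leading_multiplesE[OF mult g(3) nz])
    obtain b where b: "b \<in> set bs" "h = fst b" using h(1) by blast
    have "\<bar>expo h (lead h)\<bar> \<le> \<bar>expo (g - f) (lead (g - f))\<bar>"
      using h(5) expo_lead[OF nz] by (simp add: dvd_imp_le_int)
    also have "\<dots> \<le> absdeg q (lead (g - f))" using absdeg_ge[OF g(1) f] .
    also have "lead (g - f) = (fst (lead h), snd (lead (g - f)))" using h(3) by simp
    finally have "\<not> reduced_wrt q (lbinom b)"
      using bs[OF b(1)] b(2) h(4) by (auto simp: reduced_wrt_lbinom not_less)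
    then show ?thesis using b(1) by blast
  qed
  moreover have "ascending_chain (map lbinom bs)"
    using ascending_chain_lbinom[of bs] bs chain by blast
  ultimately show ?thesis using bs by (auto simp: characteristic_set_def)
qed

section \<open>Remainders\<close>

lemma fst_sigma_power: "fst ((sigma_binom \<sigma> ^^ t) b) = (shift ^^ t) (fst b)"
  and snd_sigma_power: "snd ((sigma_binom \<sigma> ^^ t) b) = (\<sigma> ^^ t) (snd b)"
  by (induction t) (simp_all add: sigma_binom_def)

lemma expo_shift_power:
  "expo ((shift ^^ t) f) (i, k) = (if k < t then 0 else expo f (i, k - t))"
  by (simp add: shift_power expo_monom_scale)

lemma lead_shift_power:
  assumes "f \<noteq> 0"
  shows "(shift ^^ t) f \<noteq> 0" "lead ((shift ^^ t) f) = (fst (lead f), snd (lead f) + t)"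
    "expo ((shift ^^ t) f) (fst (lead f), snd (lead f) + t) = expo f (lead f)"
proof -
  obtain i k where ik: "lead f = (i, k)" by fastforce
  show expo: "expo ((shift ^^ t) f) (fst (lead f), snd (lead f) + t) = expo f (lead f)"
    by (simp add: expo_shift_power)
  have "(shift ^^ t) f \<noteq> 0 \<and> lead ((shift ^^ t) f) = (fst (lead f), snd (lead f) + t)"
  proof (rule lead_eqI)
    show "expo ((shift ^^ t) f) (fst (lead f), snd (lead f) + t) \<noteq> 0"
      using expo expo_lead[OF assms] by simp
    fix w assume w: "var_less (fst (lead f), snd (lead f) + t) w"
    then have "var_less (lead f) (fst w, snd w - t)" if "t \<le> snd w"
      using that by (auto simp: var_less_def)
    then show "expo ((shift ^^ t) f) w = 0"
      using expo_above_lead[of f] by (cases w) (auto simp: expo_shift_power)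
  qed
  then show "(shift ^^ t) f \<noteq> 0" "lead ((shift ^^ t) f) = (fst (lead f), snd (lead f) + t)" by auto
qed

lemma prem_loop_noop: "\<bar>expo (fst h) v\<bar> < expo (fst g) v \<Longrightarrow> prem_loop v g h = h"
  by (subst prem_loop.simps) (simp add: Let_def)

lemma prem_loop_small:
  "0 < expo (fst g) v \<Longrightarrow> \<bar>expo (fst (prem_loop v g h)) v\<bar> < expo (fst g) v"
proof (induction v g h rule: prem_loop.induct)
  case (1 v g h)
  show ?case
    by (subst prem_loop.simps) (use 1 in \<open>auto simp: Let_def\<close>)
qed

text \<open>
  The loop only adds multiples of the support of \<open>g\<close>, so it keeps the exponents of all variables
  that do not appear in \<open>g\<close>; it is used for those above the leader of \<open>g\<close>.
\<close>

lemma prem_loop_above: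
  "expo (fst g) w = 0 \<Longrightarrow> expo (fst (prem_loop v g h)) w = expo (fst h) w"
proof (induction v g h rule: prem_loop.induct)
  case (1 v g h)
  show ?case
    by (subst prem_loop.simps) (use 1 in \<open>auto simp: Let_def\<close>)
qed

text \<open>
  Division multiplies by powers of \<open>g\<close>, so a group containing \<open>g\<close> contains the remainder iff it
  contains the dividend.
\<close>

lemma prem_loop_group:
  assumes "binom_group G" "g \<in> G"
  shows "prem_loop v g h \<in> G \<longleftrightarrow> h \<in> G"
proof -
  have minus: "(fst h - fst g, snd h / snd g) \<in> G \<longleftrightarrow> h \<in> G" (is ?minus)
    and plus: "(fst h + fst g, snd h * snd g) \<in> G \<longleftrightarrow> h \<in> G" (is ?plus)
    if g: "g \<in> G" for g h
  proof -
    have nz: "snd g \<noteq> 0"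
      using binom_group_nonzero[OF assms(1), of "fst g" "snd g"] g by simp
    note mult = binom_group_mult[OF assms(1), of _ _ "fst g" "snd g", unfolded prod.collapse, OF _ g]
    note div = binom_group_div[OF assms(1), of _ _ "fst g" "snd g", unfolded prod.collapse, OF _ g]
    show ?minus
      using mult[of "fst h - fst g" "snd h / snd g"] div[of "fst h" "snd h"] nz by auto
    show ?plus
      using div[of "fst h + fst g" "snd h * snd g"] mult[of "fst h" "snd h"] nz by auto
  qed
  show ?thesis using assms(2)
  proof (induction v g h rule: prem_loop.induct)
    case (1 v g h)
    show ?case
      by (subst prem_loop.simps) (use 1 minus plus in \<open>simp add: Let_def\<close>)
  qed
qed

lemma abs_expo_to_normal [simp]: "\<bar>expo (fst (to_normal h)) v\<bar> = \<bar>expo (fst h) v\<bar>"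
  by (simp add: to_normal_def)

lemma to_normal_group:
  assumes "binom_group G"
  shows "to_normal h \<in> G \<longleftrightarrow> h \<in> G"
  using binom_group_inverse[OF assms, of "fst h" "snd h"]
    binom_group_inverse[OF assms, of "- fst h" "inverse (snd h)"]
  by (cases h) (auto simp: to_normal_def)

text \<open>
  Division by \<open>\<sigma>^t g\<close> at its leader, the step from which \<open>prem\<close> is composed.
\<close>

definition prem_step ::
    "('a::field \<Rightarrow> 'a) \<Rightarrow> ('a, 'n::{finite,linorder}) binom \<Rightarrow> nat \<Rightarrow> ('a, 'n) binom \<Rightarrow> ('a, 'n) binom"
  where "prem_step \<sigma> g t h = to_normal
    (prem_loop (fst (lead (fst g)), snd (lead (fst g)) + t) ((sigma_binom \<sigma> ^^ t) g) h)"

lemma prem_altdef: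
  "prem \<sigma> f g = (if reduced_wrt (lbinom f) (lbinom g) then f
     else foldr (prem_step \<sigma> g)
       [0..<Suc (Polynomial.degree (fst f $ fst (lead (fst g))) - snd (lead (fst g)))] f)"
  by (simp add: prem_def prem_step_def[abs_def] lead_def Let_def)

text \<open>
  Only absolute values of exponents are preserved, because \<open>to_normal\<close> may invert the relation.
\<close>

lemma prem_step_facts:
  fixes g t
  defines "v \<equiv> (fst (lead (fst g)), snd (lead (fst g)) + t)"
  assumes "normal (fst g)"
  shows prem_step_above: "var_less v w \<Longrightarrow> \<bar>expo (fst (prem_step \<sigma> g t h)) w\<bar> = \<bar>expo (fst h) w\<bar>"
    and prem_step_small: "\<bar>expo (fst (prem_step \<sigma> g t h)) v\<bar> < expo (fst g) (lead (fst g))"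
    and prem_step_noop: "\<bar>expo (fst h) v\<bar> < expo (fst g) (lead (fst g)) \<Longrightarrow>
      \<bar>expo (fst (prem_step \<sigma> g t h)) w\<bar> = \<bar>expo (fst h) w\<bar>"
    and prem_step_group_noop: "\<bar>expo (fst h) v\<bar> < expo (fst g) (lead (fst g)) \<Longrightarrow>
      binom_group G \<Longrightarrow> prem_step \<sigma> g t h \<in> G \<longleftrightarrow> h \<in> G"
    and prem_step_group: "binom_group G \<Longrightarrow> (sigma_binom \<sigma> ^^ t) g \<in> G \<Longrightarrow>
      prem_step \<sigma> g t h \<in> G \<longleftrightarrow> h \<in> G"
proof -
  have nz: "fst g \<noteq> 0" "0 < expo (fst g) (lead (fst g))"
    using assms(2) by (auto simp: normal_iff)
  have lead: "lead ((shift ^^ t) (fst g)) = v"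
    "expo (fst ((sigma_binom \<sigma> ^^ t) g)) v = expo (fst g) (lead (fst g))"
    using lead_shift_power[OF nz(1)] by (auto simp: v_def fst_sigma_power)
  show "\<bar>expo (fst (prem_step \<sigma> g t h)) w\<bar> = \<bar>expo (fst h) w\<bar>" if "var_less v w"
    using expo_above_lead[of "(shift ^^ t) (fst g)" w] that lead(1)
    by (simp add: prem_step_def prem_loop_above fst_sigma_power)
  show "\<bar>expo (fst (prem_step \<sigma> g t h)) v\<bar> < expo (fst g) (lead (fst g))"
    using prem_loop_small[of "(sigma_binom \<sigma> ^^ t) g" v h] nz(2) lead(2)
    by (simp add: prem_step_def v_def)
  have noop: "prem_step \<sigma> g t h = to_normal h" if "\<bar>expo (fst h) v\<bar> < expo (fst g) (lead (fst g))"
    using that lead(2) prem_loop_noop[of h v "(sigma_binom \<sigma> ^^ t) g"]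
    by (simp add: prem_step_def v_def)
  then show "\<bar>expo (fst (prem_step \<sigma> g t h)) w\<bar> = \<bar>expo (fst h) w\<bar>"
    if "\<bar>expo (fst h) v\<bar> < expo (fst g) (lead (fst g))"
    using that by simp
  show "prem_step \<sigma> g t h \<in> G \<longleftrightarrow> h \<in> G"
    if "\<bar>expo (fst h) v\<bar> < expo (fst g) (lead (fst g))" "binom_group G"
    using noop[OF that(1)] that(2) by (simp add: to_normal_group)
  show "prem_step \<sigma> g t h \<in> G \<longleftrightarrow> h \<in> G" if "binom_group G" "(sigma_binom \<sigma> ^^ t) g \<in> G"
    using that by (simp add: prem_step_def to_normal_group prem_loop_group)
qed

lemma foldr_invariant:
  assumes "P x" "\<And>a y. a \<in> set as \<Longrightarrow> P y \<Longrightarrow> P (h a y)"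
  shows "P (foldr h as x)"
  using assms(2) by (induction as) (auto simp: assms(1))

lemma prem_invariant:
  assumes "P f" "\<And>t h. P h \<Longrightarrow> P (prem_step \<sigma> g t h)"
  shows "P (prem \<sigma> f g)"
proof -
  have "P (foldr (prem_step \<sigma> g) ts f)" for ts
    by (rule foldr_invariant[where P = P]) (use assms in auto)
  then show ?thesis using assms(1) by (simp only: prem_altdef split: if_split) blast
qed

lemma prem_group:
  assumes "normal (fst g)" "binom_group G" "\<And>t. (sigma_binom \<sigma> ^^ t) g \<in> G"
  shows "prem \<sigma> h g \<in> G \<longleftrightarrow> h \<in> G"
  by (rule prem_invariant[where P = "\<lambda>x. x \<in> G \<longleftrightarrow> h \<in> G"])
    (simp_all add: prem_step_group[OF assms(1,2)] assms(3))

text \<open>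
  Dividing in turn at the leaders of \<open>\<sigma>^t g\<close> for decreasing \<open>t\<close> makes the exponents small from the
  top down, since no step disturbs the variables above its leader.
\<close>

lemma prem_reduced:
  assumes g: "normal_binom g" and "snd f \<noteq> 0"
  shows "exp_reduced (fst (prem \<sigma> f g)) (fst g)"
proof (cases "reduced_wrt (lbinom f) (lbinom g)")
  case True
  then show ?thesis
    using reduced_wrt_lbinom_lbinom[of g f] g assms(2)
    by (simp add: prem_altdef normal_binom_def normal_def)
next
  case False
  let ?l = "fst (lead (fst g))" and ?o = "snd (lead (fst g))"
  let ?d = "expo (fst g) (lead (fst g))"
  have ng: "normal (fst g)" using g by (simp add: normal_binom_def)
  have d: "0 < ?d" using ng by (simp add: normal_iff)
  have "\<forall>k\<ge>?o. \<bar>expo (fst (foldr (prem_step \<sigma> g) [0..<n] h)) (?l, k)\<bar> < ?d"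
    if "\<forall>k\<ge>?o + n. \<bar>expo (fst h) (?l, k)\<bar> < ?d" for n h
    using that
  proof (induction n arbitrary: h)
    case (Suc n)
    have "\<bar>expo (fst (prem_step \<sigma> g n h)) (?l, k)\<bar> < ?d" if "k \<ge> ?o + n" for k
    proof (cases "k = ?o + n")
      case True
      then show ?thesis using prem_step_small[OF ng] by simp
    next
      case False
      then have "var_less (?l, ?o + n) (?l, k)" "?o + Suc n \<le> k"
        using that by (auto simp: var_less_def)
      then show ?thesis using Suc.prems prem_step_above[OF ng] by simp
    qed
    then show ?case using Suc.IH by simp
  qed simp
  moreover have "\<forall>k\<ge>?o + Suc (Polynomial.degree (fst f $ ?l) - ?o). \<bar>expo (fst f) (?l, k)\<bar> < ?d"
    using d by (auto simp: expo_def coeff_eq_0)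
  ultimately show ?thesis
    using False d by (simp add: prem_altdef exp_reduced_def del: upt_Suc)
qed

text \<open>
  Chain elements are used in the order of decreasing leaders.  A later division by \<open>g\<close> cannot spoil
  reducedness with respect to an earlier \<open>g'\<close>: steps at leaders from that of \<open>g'\<close> on in the same
  leading variable find exponents smaller than the degree of \<open>g'\<close>, hence than that of \<open>g\<close>, and do
  nothing, and all other steps take place below.
\<close>

lemma prem_keeps_reduced:
  fixes f g :: "('a::field, 'n::{finite,linorder}) binom"
  assumes g: "normal (fst g)" and less: "var_less (lead (fst g)) (lead g')"
    and red: "exp_reduced g' (fst g)" and f: "exp_reduced (fst f) g'"
  shows "exp_reduced (fst (prem \<sigma> f g)) g'"
proof (rule prem_invariant[where P = "\<lambda>x. exp_reduced (fst x) g'", OF f])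
  fix t and h :: "('a, 'n) binom" assume h: "exp_reduced (fst h) g'"
  let ?v = "(fst (lead (fst g)), snd (lead (fst g)) + t)"
  have d: "0 < expo (fst g) (lead (fst g))" using g by (simp add: normal_iff)
  have "\<bar>expo (fst (prem_step \<sigma> g t h)) (fst (lead g'), k)\<bar> = \<bar>expo (fst h) (fst (lead g'), k)\<bar>"
    if k: "k \<ge> snd (lead g')" for k
  proof (cases "var_less ?v (fst (lead g'), k)")
    case True
    then show ?thesis by (rule prem_step_above[OF g])
  next
    case False
    then have same: "fst (lead g') = fst (lead (fst g))" "k \<le> snd (lead (fst g)) + t"
      using less k by (auto simp: var_less_def)
    then have "\<bar>expo (fst h) ?v\<bar> < \<bar>expo g' (lead g')\<bar>"
      using h k by (auto simp: exp_reduced_def)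
    also have "\<dots> < expo (fst g) (lead (fst g))"
    proof -
      have "snd (lead (fst g)) \<le> snd (lead g')" using less same(1) by (auto simp: var_less_def)
      then have "\<bar>expo g' (fst (lead (fst g)), snd (lead g'))\<bar> < \<bar>expo (fst g) (lead (fst g))\<bar>"
        using red by (simp add: exp_reduced_def)
      then show ?thesis using d by (simp flip: same(1))
    qed
    finally show ?thesis by (rule prem_step_noop[OF g])
  qed
  then show "exp_reduced (fst (prem_step \<sigma> g t h)) g'" using h by (simp add: exp_reduced_def)
qed

lemma sigma_power_closed: "s ` G \<subseteq> G \<Longrightarrow> b \<in> G \<Longrightarrow> (s ^^ t) b \<in> G"
  by (induction t) auto

lemma prem_chain_reduced:
  assumes G: "binom_group G" "sigma_binom \<sigma> ` G \<subseteq> G" "f \<in> G"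
    and "set bs \<subseteq> G" "\<forall>b\<in>set bs. normal_binom b" "reduced_chain (map fst bs)"
  shows "prem_chain \<sigma> f bs \<in> G \<and> (\<forall>b\<in>set bs. exp_reduced (fst (prem_chain \<sigma> f bs)) (fst b))"
  using assms(4-)
proof (induction bs)
  case Nil
  then show ?case using G(3) by (simp add: prem_chain_def)
next
  case (Cons b bs)
  let ?h = "prem_chain \<sigma> f bs"
  have IH: "?h \<in> G" "\<And>a. a \<in> set bs \<Longrightarrow> exp_reduced (fst ?h) (fst a)"
    using Cons by (auto simp: reduced_chain_def)
  have eq: "prem_chain \<sigma> f (b # bs) = prem \<sigma> ?h b" by (simp add: prem_chain_def)
  have b: "normal_binom b" "normal (fst b)" "b \<in> G"
    using Cons.prems by (auto simp: normal_binom_def)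
  have "snd ?h \<noteq> 0" using binom_group_nonzero[OF G(1), of "fst ?h" "snd ?h"] IH(1) by simp
  then have "exp_reduced (fst (prem \<sigma> ?h b)) (fst b)" by (rule prem_reduced[OF b(1)])
  moreover have "exp_reduced (fst (prem \<sigma> ?h b)) (fst a)" if "a \<in> set bs" for a
    using Cons.prems(3) that IH(2) by (intro prem_keeps_reduced[OF b(2)]) (auto simp: reduced_chain_def)
  moreover have "prem \<sigma> ?h b \<in> G"
    using prem_group[OF b(2) G(1) sigma_power_closed[OF G(2) b(3)]] IH(1) by blast
  ultimately show ?case unfolding eq by simp
qed

text \<open>
  The remainders are relations of the character, and their supports are reduced.  The leading term
  of a nonzero support would be a multiple of a leading term of the chain, hence too large.
\<close>

lemma (in difference_field) coherent_chain_lbinom: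
  assumes L: "zx.subspace L" and rho: "character_on \<sigma> L \<rho>"
    and bs: "set bs \<subseteq> character_graph L \<rho>" "\<forall>b\<in>set bs. normal_binom b"
    and chain: "reduced_chain (map fst bs)"
    and mult: "leading_multiples (fst ` set bs) L"
  shows "coherent_chain \<sigma> bs"
  unfolding coherent_chain_def
proof (intro allI impI)
  fix i j assume "j < length bs" "i < j"
  let ?G = "character_graph L \<rho>"
  note G = binom_group_character_graph[OF rho L]
  have ij: "bs ! i \<in> ?G" "bs ! j \<in> ?G" "normal (fst (bs ! j))"
    using bs \<open>i < j\<close> \<open>j < length bs\<close> by (auto simp: normal_binom_def)
  let ?r = "prem_chain \<sigma> (Delta \<sigma> (bs ! i) (bs ! j)) bs"
  have "Delta \<sigma> (bs ! i) (bs ! j) \<in> ?G"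
    using prem_group[OF ij(3) G(1) sigma_power_closed[OF G(2) ij(2)]]
      sigma_power_closed[OF G(2) ij(1)] binom_group_one[OF G(1)]
    by (simp add: Delta_def Let_def)
  then have r: "?r \<in> ?G" "\<And>b. b \<in> set bs \<Longrightarrow> exp_reduced (fst ?r) (fst b)"
    using prem_chain_reduced[OF G _ bs chain] by blast+
  have "fst ?r = 0"
  proof (rule ccontr)
    assume nz: "fst ?r \<noteq> 0"
    have "fst ?r \<in> L" using r(1) by (auto simp: character_graph_def)
    then obtain f where f: "f \<in> fst ` set bs" "f \<noteq> 0" "fst (lead f) = fst (lead (fst ?r))"
      "snd (lead f) \<le> snd (lead (fst ?r))" "expo f (lead f) dvd expo (fst ?r) (lead (fst ?r))"
      using leading_multiplesE[OF mult _ nz] by metis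
    have "\<bar>expo f (lead f)\<bar> \<le> \<bar>expo (fst ?r) (lead (fst ?r))\<bar>"
      using f(5) expo_lead[OF nz] by (simp add: dvd_imp_le_int)
    moreover have "exp_reduced (fst ?r) f" using f(1) r(2) by blast
    ultimately show False using f(3,4) by (auto simp: exp_reduced_def)
  qed
  moreover have "snd ?r = \<rho> (fst ?r)" using r(1) by (auto simp: character_graph_def)
  ultimately show "lbinom ?r = 0"
    using character_0[OF rho zx.subspace_0[OF L]] by (simp add: lbinom_eq_0_iff prod_eq_iff)
qed

section \<open>The character of a coherent chain\<close>

inductive_set generated_group :: "('a::field, 'n::finite) binom set \<Rightarrow> ('a, 'n) binom set"
  for S where
  one: "(0, 1) \<in> generated_group S"
| base: "b \<in> S \<Longrightarrow> b \<in> generated_group S"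
| div: "(f, c) \<in> generated_group S \<Longrightarrow> (g, d) \<in> generated_group S \<Longrightarrow>
    (f - g, c / d) \<in> generated_group S"

lemma generated_group_least:
  assumes "binom_group G" "S \<subseteq> G"
  shows "generated_group S \<subseteq> G"
proof
  fix b assume "b \<in> generated_group S"
  then show "b \<in> G"
    by induction (use assms in \<open>auto intro: binom_group_one binom_group_div\<close>)
qed

lemma binom_group_generated_group:
  assumes "\<And>b. b \<in> S \<Longrightarrow> snd b \<noteq> 0"
  shows "binom_group (generated_group S)"
proof -
  have "snd b \<noteq> 0" if "b \<in> generated_group S" for b
    using that by induction (use assms in auto)
  then show ?thesis
    by (fastforce simp: binom_group_def intro: generated_group.one generated_group.div)
qed

lemma finite_highest_lead:
  assumes "finite B" "B \<noteq> {}"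
  obtains b where "b \<in> B" "\<And>b'. b' \<in> B \<Longrightarrow> \<not> var_less (l b) (l b')"
proof -
  have "\<exists>b\<in>B. \<forall>b'\<in>B. \<not> var_less (l b) (l b')"
    using assms
  proof (induction B rule: finite_ne_induct)
    case (insert x B)
    then obtain b where b: "b \<in> B" "\<forall>b'\<in>B. \<not> var_less (l b) (l b')" by blast
    show ?case
    proof (cases "var_less (l b) (l x)")
      case True
      then have "\<not> var_less (l x) (l b')" if "b' \<in> B" for b'
        using b that var_less_trans by blast
      then show ?thesis by (intro bexI[of _ x]) auto
    next
      case False
      then show ?thesis using b by blast
    qed
  qed auto
  then show thesis using that by blast
qed

text \<open>
  Relations with distinct leading positions are independent: an element of the group that they
  generate is a product of integral powers, and the leading term of the highest relation with a
  nonzero power cannot cancel.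
\<close>

lemma generated_group_lead:
  fixes S :: "('a::field, 'n::{finite,linorder}) binom set"
  assumes S: "\<And>b. b \<in> S \<Longrightarrow> fst b \<noteq> 0 \<and> snd b \<noteq> 0" and inj: "inj_on (lead \<circ> fst) S"
    and x: "(f, c) \<in> generated_group S"
  shows "f = 0 \<and> c = 1 \<or> f \<noteq> 0 \<and> (\<exists>b\<in>S. lead f = lead (fst b) \<and>
    expo (fst b) (lead (fst b)) dvd expo f (lead f))"
proof -
  define sm where "sm B n = (\<Sum>b\<in>B. of_int (n b) *s fst b)" for B and n :: "('a, 'n) binom \<Rightarrow> int"
  define pr where "pr B n = (\<Prod>b\<in>B. snd b powi n b)" for B and n :: "('a, 'n) binom \<Rightarrow> int"
  define rep where "rep x B n \<longleftrightarrow> finite B \<and> B \<subseteq> S \<and> (\<forall>b. b \<notin> B \<longrightarrow> n b = 0) \<and>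
    x = (sm B n, pr B n)" for x B n
  have ext: "sm B' n = sm B n \<and> pr B' n = pr B n"
    if "finite B'" "B \<subseteq> B'" "\<forall>b. b \<notin> B \<longrightarrow> n b = 0" for B B' n
    unfolding sm_def pr_def
    by (intro conjI sum.mono_neutral_right prod.mono_neutral_right) (use that in auto)
  have "\<exists>B n. rep (f, c) B n" using x
  proof (induction "(f, c)" arbitrary: f c)
    case one
    show ?case by (rule exI[of _ "{}"], rule exI[of _ "\<lambda>_. 0"]) (simp add: rep_def sm_def pr_def)
  next
    case base
    then show ?case
      by (intro exI[of _ "{(f, c)}"] exI[of _ "\<lambda>b. if b = (f, c) then 1 else 0"])
        (simp add: rep_def sm_def pr_def)
  next
    case (div f c g d)
    then obtain B n B' n' where B: "rep (f, c) B n" "rep (g, d) B' n'" by blast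
    let ?B = "B \<union> B'"
    have "f = sm ?B n" "c = pr ?B n" "g = sm ?B n'" "d = pr ?B n'" "finite ?B" "?B \<subseteq> S"
      using B ext[of ?B B n] ext[of ?B B' n'] by (auto simp: rep_def)
    moreover have "sm ?B n - sm ?B n' = sm ?B (\<lambda>b. n b - n' b)"
      by (simp add: sm_def sum_subtractf zx.scale_left_diff_distrib)
    moreover have "pr ?B n / pr ?B n' = pr ?B (\<lambda>b. n b - n' b)"
      unfolding pr_def prod_dividef[symmetric] using S \<open>?B \<subseteq> S\<close>
      by (intro prod.cong) (auto simp: power_int_diff)
    ultimately have "rep (f - g, c / d) ?B (\<lambda>b. n b - n' b)"
      using B by (auto simp: rep_def)
    then show ?case by blast
  qed
  then obtain B n where B: "finite B" "B \<subseteq> S" "f = sm B n" "c = pr B n"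
    by (auto simp: rep_def)
  show ?thesis
  proof (cases "\<forall>b\<in>B. n b = 0")
    case True
    then show ?thesis using B by (simp add: sm_def pr_def)
  next
    case False
    then have "finite {b \<in> B. n b \<noteq> 0}" "{b \<in> B. n b \<noteq> 0} \<noteq> {}" using B(1) by auto
    then obtain b where b: "b \<in> {b \<in> B. n b \<noteq> 0}"
      "\<And>b'. b' \<in> {b \<in> B. n b \<noteq> 0} \<Longrightarrow> \<not> var_less (lead (fst b)) (lead (fst b'))"
      by (rule finite_highest_lead[where l = "\<lambda>b. lead (fst b)"]) blast
    have expo_sm: "expo f w = (\<Sum>b\<in>B. n b * expo (fst b) w)" for w
    proof -
      have "expo (of_int m *s g) w = m * expo g w" for m and g :: "'n zvec"
        using expo_monom_scale[of m 0 g "fst w" "snd w"]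
        by (simp add: monom_0 of_int_poly)
      then show ?thesis by (simp add: B(3) sm_def expo_sum)
    qed
    have zero: "n b' * expo (fst b') w = 0"
      if "b' \<in> B" "b' \<noteq> b" "w = lead (fst b) \<or> var_less (lead (fst b)) w" for b' w
    proof (cases "n b' = 0")
      case False
      then have "\<not> var_less (lead (fst b)) (lead (fst b'))" using b(2) that(1) by blast
      moreover have "lead (fst b') \<noteq> lead (fst b)"
        using inj_onD[OF inj, of b' b] that(1,2) b(1) B(2) by auto
      ultimately have "var_less (lead (fst b')) w"
        using var_less_linear[of "lead (fst b')" "lead (fst b)"] that(3) var_less_trans by blast
      then show ?thesis by (simp add: expo_above_lead)
    qed simp
    have bS: "fst b \<noteq> 0" "b \<in> S" "n b \<noteq> 0" "b \<in> B" using b(1) B(2) S[of b] by auto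
    have "expo f (lead (fst b)) = n b * expo (fst b) (lead (fst b))"
      unfolding expo_sm sum.remove[OF B(1) bS(4)] using zero by (simp add: sum.neutral)
    moreover have "expo f w = 0" if "var_less (lead (fst b)) w" for w
      unfolding expo_sm using zero[of _ w] that expo_above_lead[OF that]
      by (intro sum.neutral) auto
    moreover have "expo (fst b) (lead (fst b)) \<noteq> 0" using bS(1) by (rule expo_lead)
    ultimately have "f \<noteq> 0 \<and> lead f = lead (fst b)"
      "expo (fst b) (lead (fst b)) dvd expo f (lead (fst b))"
      using lead_eqI[of f "lead (fst b)"] bS(3) by simp_all
    then show ?thesis using bS(2) by metis
  qed
qed

lemma reduced_chain_nth:
  assumes "reduced_chain (map fst bs)" "i < j" "j < length bs"
  shows "var_less (lead (fst (bs ! i))) (lead (fst (bs ! j)))"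
    "exp_reduced (fst (bs ! j)) (fst (bs ! i))"
  using sorted_wrt_nth_less[of _ "map fst bs" i j] assms by (auto simp: reduced_chain_def)

context difference_field
begin

lemma sigma_power_eq_0_iff: "(\<sigma> ^^ m) c = 0 \<longleftrightarrow> c = 0"
  by (induction m) (simp_all add: sigma_eq_0_iff)

lemma binom_group_sigma_preimage:
  fixes G :: "('a, 'n::finite) binom set"
  assumes "binom_group G"
  shows "binom_group {b. (sigma_binom \<sigma> ^^ m) b \<in> G}"
proof -
  have "(sigma_binom \<sigma> ^^ m) (0 :: 'n zvec, 1) = (0, 1)"
    by (induction m) (simp_all add: sigma_binom_def sigma_1)
  moreover have "(sigma_binom \<sigma> ^^ m) (f - g, c / d) =
      (fst ((sigma_binom \<sigma> ^^ m) (f, c)) - fst ((sigma_binom \<sigma> ^^ m) (g, d)),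
       snd ((sigma_binom \<sigma> ^^ m) (f, c)) / snd ((sigma_binom \<sigma> ^^ m) (g, d)))"
    for f g :: "'n zvec" and c d
    by (induction m) (simp_all add: sigma_binom_def shift_diff sigma_divide)
  moreover have "c \<noteq> 0" if "(sigma_binom \<sigma> ^^ m) (f, c) \<in> G" for f c
    using binom_group_nonzero[OF assms] that snd_sigma_power[of m \<sigma> "(f, c)"]
      sigma_power_eq_0_iff[of m c] by (metis prod.collapse snd_conv)
  ultimately show ?thesis
    using assms unfolding binom_group_def[of "{b. _ b}"]
    by (auto intro!: binom_group_div binom_group_one)
qed

text \<open>
  Coherence says that \<open>\<sigma>^s A_i\<close>, whose leader is that of \<open>A_j\<close>, is a product of powers of \<open>A_j\<close>
  and of transforms of chain elements with smaller leaders: at that leader and above, all exponents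
  are too small for a further division.
\<close>

lemma coherent_relation:
  assumes bs: "\<And>b. b \<in> set bs \<Longrightarrow> normal_binom b"
    and chain: "reduced_chain (map fst bs)" and coh: "coherent_chain \<sigma> bs"
    and ij: "i < j" "j < length bs" "fst (lead (fst (bs ! i))) = fst (lead (fst (bs ! j)))"
    and G: "binom_group G" "bs ! j \<in> G"
    and lower: "\<And>b t. b \<in> set bs \<Longrightarrow>
      var_less (fst (lead (fst b)), snd (lead (fst b)) + t) (lead (fst (bs ! j))) \<Longrightarrow>
      (sigma_binom \<sigma> ^^ t) b \<in> G"
  shows "(sigma_binom \<sigma> ^^ (snd (lead (fst (bs ! j))) - snd (lead (fst (bs ! i))))) (bs ! i) \<in> G"
proof -
  define v where "v = lead (fst (bs ! j))"
  define d where "d = expo (fst (bs ! j)) v"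
  define a where "a = (sigma_binom \<sigma> ^^ (snd v - snd (lead (fst (bs ! i))))) (bs ! i)"
  have nj: "normal_binom (bs ! j)" "normal (fst (bs ! j))" "0 < d"
    using bs[OF nth_mem[OF ij(2)]] by (auto simp: normal_binom_def normal_iff d_def v_def)
  have ni: "fst (bs ! i) \<noteq> 0" "snd (bs ! i) \<noteq> 0"
    using bs[OF nth_mem, of i] ij by (auto simp: normal_binom_def normal_def)
  have less: "snd (lead (fst (bs ! i))) < snd v"
    using reduced_chain_nth(1)[OF chain ij(1,2)] ij(3) by (auto simp: var_less_def v_def)
  have lead_a: "lead (fst a) = v" "snd a \<noteq> 0"
    using lead_shift_power(2)[OF ni(1)] less ij(3) ni(2)
    by (simp_all add: a_def fst_sigma_power snd_sigma_power v_def sigma_power_eq_0_iff)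
  define D where "D = Delta \<sigma> (bs ! i) (bs ! j)"
  have D: "D = prem \<sigma> a (bs ! j)"
    using ij(3) by (simp add: D_def Delta_def Let_def a_def v_def lead_def)
  have "(\<forall>w. var_less v w \<longrightarrow> expo (fst D) w = 0) \<and> (D \<in> G \<longleftrightarrow> a \<in> G)"
    unfolding D
  proof (rule prem_invariant[where
        P = "\<lambda>h. (\<forall>w. var_less v w \<longrightarrow> expo (fst h) w = 0) \<and> (h \<in> G \<longleftrightarrow> a \<in> G)"])
    show "(\<forall>w. var_less v w \<longrightarrow> expo (fst a) w = 0) \<and> (a \<in> G \<longleftrightarrow> a \<in> G)"
      using lead_a(1) expo_above_lead by blast
    fix t h assume h: "(\<forall>w. var_less v w \<longrightarrow> expo (fst h) w = 0) \<and> (h \<in> G \<longleftrightarrow> a \<in> G)"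
    let ?u = "(fst (lead (fst (bs ! j))), snd (lead (fst (bs ! j))) + t)"
    let ?r = "prem_step \<sigma> (bs ! j) t h"
    show "(\<forall>w. var_less v w \<longrightarrow> expo (fst ?r) w = 0) \<and> (?r \<in> G \<longleftrightarrow> a \<in> G)"
    proof (cases "t = 0")
      case True
      then have "?u = v" by (simp add: v_def)
      then have "\<bar>expo (fst ?r) w\<bar> = 0" if "var_less v w" for w
        using prem_step_above[OF nj(2), of t w \<sigma> h] h that by simp
      moreover have "?r \<in> G \<longleftrightarrow> h \<in> G"
        using prem_step_group[OF nj(2) G(1), of t \<sigma> h] G(2) True by simp
      ultimately show ?thesis using h by simp
    next
      case False
      then have "var_less v ?u" by (auto simp: var_less_def v_def)
      then have small: "\<bar>expo (fst h) ?u\<bar> < expo (fst (bs ! j)) (lead (fst (bs ! j)))"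
        using h nj(3) by (simp add: d_def v_def)
      have "\<bar>expo (fst ?r) w\<bar> = 0" if "var_less v w" for w
      proof -
        have "expo (fst h) w = 0" using h that by blast
        then show ?thesis using prem_step_noop[OF nj(2) small, of \<sigma> w] by simp
      qed
      moreover have "?r \<in> G \<longleftrightarrow> h \<in> G" by (rule prem_step_group_noop[OF nj(2) small G(1)])
      ultimately show ?thesis using h by simp
    qed
  qed
  moreover have "\<bar>expo (fst D) v\<bar> < d"
    using prem_reduced[OF nj(1) lead_a(2), of \<sigma>, folded D, unfolded exp_reduced_def,
        rule_format, of "snd v"] nj(3)
    by (simp add: d_def v_def)
  ultimately have D_inv: "\<forall>w. var_less v w \<longrightarrow> expo (fst D) w = 0" "\<bar>expo (fst D) v\<bar> < d"
      "D \<in> G \<longleftrightarrow> a \<in> G"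
    by blast+
  \<comment> \<open>What all divisions after the first one preserve; by the first two conditions, a division at
    \<open>v\<close> or above it does nothing, and the divisions below \<open>v\<close> use relations in \<open>G\<close>.\<close>
  define inv where "inv h \<longleftrightarrow> (\<forall>w. var_less v w \<longrightarrow> expo (fst h) w = 0) \<and>
    \<bar>expo (fst h) v\<bar> < d \<and> (h \<in> G \<longleftrightarrow> a \<in> G)" for h
  have inv_cong: "inv h'" if "inv h" "h' \<in> G \<longleftrightarrow> h \<in> G"
      and eq: "\<And>w. w = v \<or> var_less v w \<Longrightarrow> \<bar>expo (fst h') w\<bar> = \<bar>expo (fst h) w\<bar>" for h h'
  proof -
    have "expo (fst h') w = 0" if "var_less v w" for w
    proof -
      have "expo (fst h) w = 0" using \<open>inv h\<close> that unfolding inv_def by blast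
      then show ?thesis using eq[of w] that by simp
    qed
    moreover have "\<bar>expo (fst h') v\<bar> < d"
      using \<open>inv h\<close> eq[of v] unfolding inv_def by simp
    ultimately show ?thesis using \<open>inv h\<close> that(2) unfolding inv_def by blast
  qed
  have step: "inv (prem_step \<sigma> b t h)" if "b \<in> set bs" "inv h" for b t h
  proof -
    let ?u = "(fst (lead (fst b)), snd (lead (fst b)) + t)"
    have nb: "normal (fst b)" "0 < expo (fst b) (lead (fst b))"
      using bs[OF that(1)] by (auto simp: normal_binom_def normal_iff)
    have noop: ?thesis if "\<bar>expo (fst h) ?u\<bar> < expo (fst b) (lead (fst b))"
      by (rule inv_cong[OF \<open>inv h\<close> prem_step_group_noop[OF nb(1) that G(1)]
            prem_step_noop[OF nb(1) that]])
    \<comment> \<open>At \<open>v\<close> itself only \<open>A_j\<close> and earlier elements of the chain can divide, and the degrees of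
      the latter are larger than \<open>d\<close>.\<close>
    consider "var_less ?u v" | "?u = v" | "var_less v ?u" using var_less_linear by blast
    then show ?thesis
    proof cases
      case 1
      then have "\<bar>expo (fst (prem_step \<sigma> b t h)) w\<bar> = \<bar>expo (fst h) w\<bar>" if "w = v \<or> var_less v w" for w
        using that 1 var_less_trans[OF 1, of w] by (intro prem_step_above[OF nb(1)]) auto
      moreover have "prem_step \<sigma> b t h \<in> G \<longleftrightarrow> h \<in> G"
        using prem_step_group[OF nb(1) G(1)] lower[OF that(1)] 1 by (simp add: v_def)
      ultimately show ?thesis by (intro inv_cong[OF \<open>inv h\<close>])
    next
      case 2
      obtain k where k: "k < length bs" "b = bs ! k" using \<open>b \<in> set bs\<close>
        by (metis in_set_conv_nth)
      have not_less: "\<not> var_less v (lead (fst b))"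
        unfolding 2[symmetric] by (simp add: var_less_def)
      have "k \<le> j"
      proof (rule ccontr)
        assume "\<not> k \<le> j"
        then have "j < k" by simp
        then show False
          using reduced_chain_nth(1)[OF chain _ k(1)] not_less unfolding v_def k(2) by blast
      qed
      have "d \<le> expo (fst b) (lead (fst b))"
      proof (cases "k = j")
        case False
        then have "exp_reduced (fst (bs ! j)) (fst b)"
          using reduced_chain_nth(2)[OF chain _ ij(2), of k] \<open>k \<le> j\<close> k by simp
        then have "\<bar>expo (fst (bs ! j)) ?u\<bar> < \<bar>expo (fst b) (lead (fst b))\<bar>"
          by (simp add: exp_reduced_def)
        then show ?thesis using nj(3) nb(2) 2 by (simp add: d_def)
      qed (simp add: d_def k v_def)
      then show ?thesis using noop 2 \<open>inv h\<close> by (simp add: inv_def)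
    next
      case 3
      then show ?thesis using noop \<open>inv h\<close> nb(2) by (simp add: inv_def)
    qed
  qed
  have "inv D" using D_inv by (simp add: inv_def)
  then have "inv (prem_chain \<sigma> D bs)"
    unfolding prem_chain_def
    by (rule foldr_invariant[where P = inv]) (rule prem_invariant[where P = inv], simp, rule step)
  moreover have "prem_chain \<sigma> D bs = (0, 1)"
    using coh ij by (simp add: coherent_chain_def D_def lbinom_eq_0_iff)
  ultimately have "a \<in> G" using binom_group_one[OF G(1)] by (simp add: inv_def)
  then show ?thesis by (simp add: a_def v_def)
qed

text \<open>
  Two transforms with the same leader come from chain elements with the same leading variable, and
  the later element is better, because its degree is smaller.  The group generated by the best
  transforms is the graph of the character.
\<close>

lemma coherent_chain_character:
  fixes bs :: "('a, 'n::{finite,linorder}) binom list"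
  assumes bs: "\<And>b. b \<in> set bs \<Longrightarrow> normal_binom b"
    and chain: "reduced_chain (map fst bs)" and coh: "coherent_chain \<sigma> bs"
  obtains \<rho> where "character_on \<sigma> (zx_span (fst ` set bs)) \<rho>"
    "\<And>b. b \<in> set bs \<Longrightarrow> \<rho> (fst b) = snd b"
    "leading_multiples (fst ` set bs) (zx_span (fst ` set bs))"
proof -
  let ?L = "zx_span (fst ` set bs)"
  define pos where "pos b t = (fst (lead (fst b)), snd (lead (fst b)) + t)" 
    for b :: "('a, 'n) binom" and t
  define best where "best b t \<longleftrightarrow> (\<forall>b'\<in>set bs. fst (lead (fst b')) = fst (lead (fst b)) \<and>
    snd (lead (fst b')) \<le> snd (lead (fst b)) + t \<longrightarrow> snd (lead (fst b')) \<le> snd (lead (fst b)))"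
    for b :: "('a, 'n) binom" and t
  define S where "S = {(sigma_binom \<sigma> ^^ t) b | b t. b \<in> set bs \<and> best b t}"
  let ?G = "generated_group S"
  have nz: "fst b \<noteq> 0" "snd b \<noteq> 0" if "b \<in> set bs" for b
    using bs[OF that] by (auto simp: normal_binom_def normal_def)
  have lead_sigma: "fst ((sigma_binom \<sigma> ^^ t) b) \<noteq> 0" "lead (fst ((sigma_binom \<sigma> ^^ t) b)) = pos b t"
    "expo (fst ((sigma_binom \<sigma> ^^ t) b)) (pos b t) = expo (fst b) (lead (fst b))"
    "snd ((sigma_binom \<sigma> ^^ t) b) \<noteq> 0"
    if "b \<in> set bs" for b t
    using lead_shift_power[OF nz(1)[OF that]] nz(2)[OF that]
    by (simp_all add: fst_sigma_power snd_sigma_power pos_def sigma_power_eq_0_iff)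
  have lead_inj: "b = b'" if "b \<in> set bs" "b' \<in> set bs" "lead (fst b) = lead (fst b')" for b b'
  proof -
    obtain i j where ij: "i < length bs" "b = bs ! i" "j < length bs" "b' = bs ! j"
      using \<open>b \<in> set bs\<close> \<open>b' \<in> set bs\<close> by (metis in_set_conv_nth)
    then have "\<not> i < j" "\<not> j < i"
      using reduced_chain_nth(1)[OF chain, of i j] reduced_chain_nth(1)[OF chain, of j i] that(3)
      by auto
    then show ?thesis using ij by (simp add: not_less_iff_gr_or_eq)
  qed
  have S: "fst x \<noteq> 0 \<and> snd x \<noteq> 0" if "x \<in> S" for x
    using that lead_sigma by (auto simp: S_def)
  have S_inj: "inj_on (lead \<circ> fst) S"
  proof (rule inj_onI)
    fix x y assume "x \<in> S" "y \<in> S" and eq: "(lead \<circ> fst) x = (lead \<circ> fst) y"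
    then obtain b t b' t' where bt: "b \<in> set bs" "best b t" "x = (sigma_binom \<sigma> ^^ t) b"
      "b' \<in> set bs" "best b' t'" "y = (sigma_binom \<sigma> ^^ t') b'"
      by (auto simp: S_def)
    then have "pos b t = pos b' t'" using eq lead_sigma(2) by simp
    then have pos: "fst (lead (fst b)) = fst (lead (fst b'))"
      "snd (lead (fst b)) + t = snd (lead (fst b')) + t'" by (auto simp: pos_def)
    have "snd (lead (fst b)) \<le> snd (lead (fst b'))"
      using bt(5)[unfolded best_def, rule_format, OF bt(1)] pos by simp
    moreover have "snd (lead (fst b')) \<le> snd (lead (fst b))"
      using bt(2)[unfolded best_def, rule_format, OF bt(4)] pos by simp
    ultimately have "lead (fst b) = lead (fst b')" "t = t'" using pos by (simp_all add: prod_eq_iff)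
    then show "x = y" using lead_inj[OF bt(1,4)] bt(3,6) by simp
  qed
  have G: "binom_group ?G" using S by (intro binom_group_generated_group) blast
  \<comment> \<open>By induction on the leader: coherence of \<open>b\<close> and the better \<open>b'\<close>, transformed by \<open>\<sigma>^m\<close> so
    that the leaders are at \<open>v\<close>, reduces a transform that is not best to lower ones.  The transformed
    coherence relation is the untransformed one for the preimage \<open>?H\<close> of the group.\<close>
  have all: "(sigma_binom \<sigma> ^^ t) b \<in> ?G" if "b \<in> set bs" "pos b t = v" for b t v
    using that
  proof (induction v arbitrary: b t rule: var_less_induct)
    case (1 v)
    show ?case
    proof (cases "best b t")
      case True
      then have "(sigma_binom \<sigma> ^^ t) b \<in> S" using 1(2) unfolding S_def by blast
      then show ?thesis by (rule generated_group.base)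
    next
      case False
      define C where "C = {b' \<in> set bs. fst (lead (fst b')) = fst (lead (fst b)) \<and>
        snd (lead (fst b')) \<le> snd (lead (fst b)) + t}"
      have "b \<in> C" using 1(2) by (simp add: C_def)
      moreover have "finite C" by (simp add: C_def)
      ultimately have C: "finite C" "C \<noteq> {}" by blast+
      then obtain b' where b': "b' \<in> C"
        "\<And>b''. b'' \<in> C \<Longrightarrow> \<not> var_less (lead (fst b')) (lead (fst b''))"
        using finite_highest_lead[of C "\<lambda>b. lead (fst b)"] by blast
      then have max: "snd (lead (fst b'')) \<le> snd (lead (fst b'))" if "b'' \<in> C" for b''
      proof -
        have "fst (lead (fst b'')) = fst (lead (fst b'))" using that b'(1) by (simp add: C_def)
        then show ?thesis using b'(2)[OF that] by (simp add: var_less_def)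
      qed
      obtain b'' where b'': "b'' \<in> C" "snd (lead (fst b)) < snd (lead (fst b''))"
        using False unfolding best_def C_def by (auto simp: not_le)
      then have less: "snd (lead (fst b)) < snd (lead (fst b'))" using max[OF b''(1)] by simp
      have same: "fst (lead (fst b')) = fst (lead (fst b))" "b' \<in> set bs" using b' by (auto simp: C_def)
      define m where "m = snd (lead (fst b)) + t - snd (lead (fst b'))"
      have m: "snd (lead (fst b')) + m = snd (lead (fst b)) + t"
        using b'(1) by (auto simp: C_def m_def)
      have t: "t = m + (snd (lead (fst b')) - snd (lead (fst b)))" using m less by simp
      have v: "v = (fst (lead (fst b')), snd (lead (fst b')) + m)"
        using 1(3) m same by (simp add: pos_def)
      obtain i j where ij: "i < length bs" "b = bs ! i" "j < length bs" "b' = bs ! j"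
        using 1(2) same(2) by (metis in_set_conv_nth)
      have "i < j"
      proof (rule ccontr)
        assume "\<not> i < j"
        moreover have "i \<noteq> j" using less ij by auto
        ultimately have "var_less (lead (fst b')) (lead (fst b))"
          using reduced_chain_nth(1)[OF chain, of j i] ij by simp
        then show False using less same by (auto simp: var_less_def)
      qed
      let ?H = "{x. (sigma_binom \<sigma> ^^ m) x \<in> ?G}"
      have "best b' m" using max same m by (auto simp: best_def C_def)
      then have "(sigma_binom \<sigma> ^^ m) b' \<in> S" using same(2) unfolding S_def by blast
      then have b'_in: "b' \<in> ?H" by (simp add: generated_group.base)
      have lower: "(sigma_binom \<sigma> ^^ s) a \<in> ?H"
        if "a \<in> set bs" "var_less (fst (lead (fst a)), snd (lead (fst a)) + s) (lead (fst b'))" for a s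
      proof -
        have "var_less (pos a (m + s)) v"
          using that(2) v by (auto simp: pos_def var_less_def)
        then have "(sigma_binom \<sigma> ^^ (m + s)) a \<in> ?G" using 1(1) that(1) by blast
        then show ?thesis by (simp add: funpow_add)
      qed
      have "(sigma_binom \<sigma> ^^ (snd (lead (fst b')) - snd (lead (fst b)))) b \<in> ?H"
        using coherent_relation[OF bs chain coh \<open>i < j\<close> ij(3) _ binom_group_sigma_preimage[OF G]]
          ij same b'_in lower by simp
      then show ?thesis by (subst t) (simp add: funpow_add)
    qed
  qed
  have "S \<subseteq> {x. (sigma_binom \<sigma> ^^ 1) x \<in> ?G}"
  proof
    fix x assume "x \<in> S"
    then obtain b t where bt: "b \<in> set bs" "x = (sigma_binom \<sigma> ^^ t) b" by (auto simp: S_def)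
    then show "x \<in> {x. (sigma_binom \<sigma> ^^ 1) x \<in> ?G}" using all[of b "Suc t"] by simp
  qed
  then have closed: "sigma_binom \<sigma> ` ?G \<subseteq> ?G"
    using generated_group_least[OF binom_group_sigma_preimage[OF G, of 1], of S] by auto
  note lead_G = generated_group_lead[OF S S_inj]
  obtain \<rho> where rho: "character_on \<sigma> (fst ` ?G) \<rho>" "\<And>f c. (f, c) \<in> ?G \<Longrightarrow> \<rho> f = c"
      "zx.subspace (fst ` ?G)"
    using character_of_group[OF G closed] lead_G by blast
  have bs_G: "b \<in> ?G" if "b \<in> set bs" for b using all[OF that, of 0] by simp
  have span_shift: "(shift ^^ t) f \<in> ?L" if "f \<in> ?L" for f t
    using that by (induction t) (auto intro: subspace_shift[OF zx.subspace_span])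
  have "binom_group {b. fst b \<in> ?L \<and> snd b \<noteq> 0}"
    by (auto simp: binom_group_def zx.span_zero zx.span_diff)
  moreover have "S \<subseteq> {b. fst b \<in> ?L \<and> snd b \<noteq> 0}"
  proof
    fix x assume x: "x \<in> S"
    then obtain b t where bt: "b \<in> set bs" "x = (sigma_binom \<sigma> ^^ t) b" unfolding S_def by blast
    then have "fst b \<in> ?L" by (simp add: zx.span_base)
    then have "fst x \<in> ?L" unfolding bt(2) fst_sigma_power by (rule span_shift)
    then show "x \<in> {b. fst b \<in> ?L \<and> snd b \<noteq> 0}" using S[OF x] by simp
  qed
  ultimately have "?G \<subseteq> {b. fst b \<in> ?L \<and> snd b \<noteq> 0}" by (rule generated_group_least)
  moreover have "?L \<subseteq> fst ` ?G" using bs_G rho(3) by (intro zx.span_minimal) auto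
  ultimately have L: "fst ` ?G = ?L" by auto
  have "leading_multiples (fst ` set bs) ?L"
    unfolding leading_multiples_def
  proof
    fix h assume h: "h \<in> ?L - {0}"
    then have "h \<in> fst ` ?G" using L by simp
    then obtain c where "(h, c) \<in> ?G" by auto
    then obtain x where x: "x \<in> S" "lead h = lead (fst x)"
      "expo (fst x) (lead (fst x)) dvd expo h (lead h)"
      using lead_G h by blast
    then obtain b t where bt: "b \<in> set bs" "x = (sigma_binom \<sigma> ^^ t) b" by (auto simp: S_def)
    then have "lead h = pos b t" "expo (fst b) (lead (fst b)) dvd expo h (lead h)"
      using x lead_sigma[OF bt(1), of t] by simp_all
    then have "mon_multiple (LT h) (LT (fst b))"
      using h nz(1)[OF bt(1)] expo_lead[of h] by (simp add: LT_lead mon_multiple_iff pos_def)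
    then show "\<exists>f\<in>fst ` set bs - {0}. mon_multiple (LT h) (LT f)"
      using bt(1) nz(1) by blast
  qed
  moreover have "\<rho> (fst b) = snd b" if "b \<in> set bs" for b
    using rho(2)[of "fst b" "snd b"] bs_G[OF that] by simp
  ultimately show thesis using that rho(1) unfolding L by blast
qed

end

section \<open>Existence of sharply reduced Groebner bases\<close>

lemma int_subgroup_principal:
  fixes J :: "int set"
  assumes "0 \<in> J" "\<And>a b. a \<in> J \<Longrightarrow> b \<in> J \<Longrightarrow> a - b \<in> J"
  shows "\<exists>d\<ge>0. \<forall>a. a \<in> J \<longleftrightarrow> d dvd a"
proof (cases "J = {0}")
  case True
  then show ?thesis by (intro exI[of _ 0]) auto
next
  case False
  have neg: "- a \<in> J" if "a \<in> J" for a using assms(2)[OF assms(1) that] by simp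
  have add: "a + b \<in> J" if "a \<in> J" "b \<in> J" for a b using assms(2)[OF that(1) neg[OF that(2)]] by simp
  have mult: "a * c \<in> J" if "a \<in> J" for a c
  proof (induction c rule: int_induct[where k = 0])
    case base then show ?case using assms(1) by simp
  next
    case (step1 c) then show ?case using add that by (simp add: distrib_left)
  next
    case (step2 c) then show ?case using assms(2) that by (simp add: right_diff_distrib)
  qed
  obtain a where a: "a \<in> J" "a \<noteq> 0" using False assms(1) by blast
  define P where "P n \<longleftrightarrow> 0 < n \<and> int n \<in> J" for n
  have "P (nat \<bar>a\<bar>)" using a neg[of a] by (auto simp: P_def abs_if)
  then have least: "P (LEAST n. P n)" "\<And>m. P m \<Longrightarrow> (LEAST n. P n) \<le> m"
    by (auto intro: LeastI Least_le)
  define d where "d = int (LEAST n. P n)"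
  have d: "0 < d" "d \<in> J" using least(1) by (auto simp: d_def P_def)
  have "d dvd b" if "b \<in> J" for b
  proof (rule ccontr)
    assume "\<not> d dvd b"
    then have "0 < b mod d" using d(1) by (simp add: dvd_eq_mod_eq_0 order_less_le)
    moreover have "b mod d \<in> J"
      using assms(2)[OF that mult[OF d(2), of "b div d"]] by (simp add: minus_mult_div_eq_mod)
    ultimately have "P (nat (b mod d))" by (simp add: P_def)
    then have "d \<le> b mod d" using least(2) \<open>0 < b mod d\<close> by (fastforce simp: d_def)
    then show False using pos_mod_bound[OF d(1), of b] by simp
  qed
  moreover have "b \<in> J" if "d dvd b" for b using mult[OF d(2)] that by (auto elim: dvdE)
  ultimately show ?thesis using d(1) by (intro exI[of _ d]) auto
qed

text \<open>
  Here \<open>d v\<close> generates the ideal of the coefficients at \<open>v\<close> of the lattice elements without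
  monomials above \<open>v\<close>.
\<close>

locale lattice_leading =
  fixes L :: "('n::{finite,linorder}) zvec set" and d :: "'n lvar \<Rightarrow> int"
  assumes L: "zx.subspace L" and d_nonneg: "0 \<le> d v"
    and d_iff: "(\<exists>f\<in>L. expo f v = a \<and> (\<forall>w. var_less v w \<longrightarrow> expo f w = 0)) \<longleftrightarrow> d v dvd a"

lemma lattice_leading_exists:
  assumes "zx.subspace (L :: ('n::{finite,linorder}) zvec set)"
  obtains d where "lattice_leading L d"
proof -
  have "\<exists>d\<ge>0. \<forall>a. (\<exists>f\<in>L. expo f v = a \<and> (\<forall>w. var_less v w \<longrightarrow> expo f w = 0)) \<longleftrightarrow> d dvd a" for v
  proof -
    define J where "J = {a. \<exists>f\<in>L. expo f v = a \<and> (\<forall>w. var_less v w \<longrightarrow> expo f w = 0)}"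
    have "0 \<in> J" using zx.subspace_0[OF assms] by (auto simp: J_def intro!: bexI[of _ 0])
    moreover have "a - b \<in> J" if ab: "a \<in> J" "b \<in> J" for a b
    proof -
      obtain f g where "f \<in> L" "g \<in> L" "expo f v = a" "expo g v = b"
        "\<forall>w. var_less v w \<longrightarrow> expo f w = 0" "\<forall>w. var_less v w \<longrightarrow> expo g w = 0"
        using ab by (auto simp: J_def)
      then show ?thesis
        unfolding J_def using zx.subspace_diff[OF assms, of f g]
        by (intro CollectI bexI[of _ "f - g"]) auto
    qed
    ultimately have "\<exists>d\<ge>0. \<forall>a. a \<in> J \<longleftrightarrow> d dvd a" by (rule int_subgroup_principal)
    then show ?thesis by (simp add: J_def)
  qed
  then obtain d where "\<And>v. 0 \<le> d v \<and>
      (\<forall>a. (\<exists>f\<in>L. expo f v = a \<and> (\<forall>w. var_less v w \<longrightarrow> expo f w = 0)) \<longleftrightarrow> d v dvd a)"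
    by metis
  then have "lattice_leading L d" using assms by unfold_locales blast+
  then show thesis by (rule that)
qed

context lattice_leading
begin

lemma d_dvd_lead: "h \<in> L \<Longrightarrow> d (lead h) dvd expo h (lead h)"
  using d_iff[of "lead h"] expo_above_lead by blast

lemma d_element:
  obtains f where "f \<in> L" "expo f v = d v" "\<And>w. var_less v w \<Longrightarrow> expo f w = 0"
proof -
  have "d v dvd d v" by simp
  then obtain f where "f \<in> L" "expo f v = d v" "\<forall>w. var_less v w \<longrightarrow> expo f w = 0"
    unfolding d_iff[symmetric] by blast
  then show thesis using that by blast
qed

text \<open>
  Multiplication by \<open>x\<close> keeps leading coefficients.
\<close>

lemma d_Suc_dvd: "d (i, Suc k) dvd d (i, k)"
proof -
  obtain f where f: "f \<in> L" "expo f (i, k) = d (i, k)" "\<And>w. var_less (i, k) w \<Longrightarrow> expo f w = 0"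
    using d_element[of "(i, k)"] by blast
  have expo: "expo (shift f) w = (if snd w = 0 then 0 else expo f (fst w, snd w - 1))" for w
    using expo_shift_power[of 1 f "fst w" "snd w"] by auto
  have "expo (shift f) (i, Suc k) = d (i, k)" by (simp add: expo f(2))
  moreover have "expo (shift f) w = 0" if "var_less (i, Suc k) w" for w
    unfolding expo using f(3)[of "(fst w, snd w - 1)"] that by (auto simp: var_less_def)
  ultimately show ?thesis using d_iff[of "(i, Suc k)"] subspace_shift[OF L f(1)] by metis
qed

lemma d_dvd_mono: "k \<le> l \<Longrightarrow> d (i, l) dvd d (i, k)"
  by (induction rule: dec_induct) (auto intro: dvd_trans[OF d_Suc_dvd])

text \<open>
  Reducing the highest monomial modulo \<open>d\<close> at its position changes lower monomials only, so the
  reduction of all monomials from the top down ends by well-foundedness of the order of positions.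
  Remainders are taken in \<open>{0..<d}\<close>.
\<close>

lemma reduce_below:
  "(\<And>w. \<not> var_less w v \<Longrightarrow> expo f w = 0) \<Longrightarrow>
    \<exists>g. f - g \<in> L \<and> (\<forall>w. \<not> var_less w v \<longrightarrow> expo g w = 0) \<and>
      (\<forall>w. d w \<noteq> 0 \<longrightarrow> 0 \<le> expo g w \<and> expo g w < d w)"
proof (induction v arbitrary: f rule: var_less_induct)
  case (1 v)
  show ?case
  proof (cases "f = 0")
    case True
    then show ?thesis
      using zx.subspace_0[OF L] d_nonneg
      by (intro exI[of _ 0]) (auto simp: order_less_le)
  next
    case False
    define u where "u = lead f"
    have u: "var_less u v" using 1(2)[of u] expo_lead[OF False] unfolding u_def by blast
    obtain e where e: "e \<in> L" "expo e u = d u" "\<And>w. var_less u w \<Longrightarrow> expo e w = 0"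
      using d_element[of u] by blast
    define q where "q = expo f u div d u"
    define m where "m = axis (fst u) (monom (expo f u mod d u) (snd u))"
    have expo_m: "expo m w = (if w = u then expo f u mod d u else 0)" for w
      by (cases w; cases u) (auto simp: m_def expo_axis)
    have expo_qe: "expo ([:q:] *s e) w = q * expo e w" for w
      using expo_monom_scale[of q 0 e "fst w" "snd w"] by (simp add: monom_0)
    have below: "expo (f - [:q:] *s e - m) w = 0" if "\<not> var_less w u" for w
    proof (cases "w = u")
      case True
      have "q * d u + expo f u mod d u = expo f u" by (simp add: q_def)
      then show ?thesis using True e(2) by (simp add: expo_qe expo_m)
    next
      case neq: False
      then have "var_less u w" using that var_less_linear by blast
      then show ?thesis
        using e(3) expo_above_lead[of f w] neq by (simp add: expo_qe expo_m u_def)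
    qed
    obtain g where g: "f - [:q:] *s e - m - g \<in> L"
      "\<And>w. \<not> var_less w u \<Longrightarrow> expo g w = 0"
      "\<And>w. d w \<noteq> 0 \<Longrightarrow> 0 \<le> expo g w \<and> expo g w < d w"
      using 1(1)[of u "f - [:q:] *s e - m"] u below by blast
    have "[:q:] *s e \<in> L" using zx.subspace_scale[OF L e(1)] .
    then have "f - (m + g) \<in> L"
      using zx.subspace_add[OF L g(1), of "[:q:] *s e"] by (simp add: algebra_simps)
    moreover have "expo (m + g) w = 0" if "\<not> var_less w v" for w
      using that u g(2)[of w] var_less_trans[of w u v] by (auto simp: expo_m)
    moreover have "0 \<le> expo (m + g) w \<and> expo (m + g) w < d w" if "d w \<noteq> 0" for w
    proof (cases "w = u")
      case True
      then have "0 < d u" using that d_nonneg[of u] by simp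
      then show ?thesis using True g(2)[of u] by (simp add: expo_m)
    qed (use g(3)[OF that] in \<open>simp add: expo_m\<close>)
    ultimately show ?thesis by blast
  qed
qed

text \<open>
  Only where the divisor chain \<open>d (i, 0), d (i, 1), \<dots>\<close> drops does a leading coefficient appear
  that does not come from a lower position.
\<close>

definition jumps :: "'n lvar set" where
  "jumps = {(i, k). d (i, k) \<noteq> 0 \<and> (\<forall>l<k. d (i, l) \<noteq> d (i, k))}"

text \<open>
  For fixed \<open>i\<close> the values of \<open>d\<close> at the jumps are distinct, and they divide the first nonzero
  value.
\<close>

lemma finite_jumps: "finite jumps"
proof -
  have "finite {k. (i, k) \<in> jumps}" for i
  proof (cases "\<exists>k. d (i, k) \<noteq> 0")
    case True
    define k0 where "k0 = (LEAST k. d (i, k) \<noteq> 0)"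
    have k0: "d (i, k0) \<noteq> 0" unfolding k0_def using True by (rule LeastI_ex)
    have ge: "k0 \<le> k" if "(i, k) \<in> jumps" for k
      using that unfolding k0_def jumps_def by (auto intro: Least_le)
    have "(\<lambda>k. d (i, k)) ` {k. (i, k) \<in> jumps} \<subseteq> {a. a dvd d (i, k0)}"
      using ge d_dvd_mono by auto
    then have "finite ((\<lambda>k. d (i, k)) ` {k. (i, k) \<in> jumps})"
      using finite_divisors_int[OF k0] by (rule finite_subset)
    moreover have "inj_on (\<lambda>k. d (i, k)) {k. (i, k) \<in> jumps}"
    proof (rule inj_onI)
      fix k l assume "k \<in> {k. (i, k) \<in> jumps}" "l \<in> {k. (i, k) \<in> jumps}" "d (i, k) = d (i, l)"
      then have "\<not> k < l" "\<not> l < k" by (auto simp: jumps_def)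
      then show "k = l" by simp
    qed
    ultimately show ?thesis by (rule finite_imageD)
  qed (simp add: jumps_def)
  then have "finite (\<Union>i. Pair i ` {k. (i, k) \<in> jumps})" by simp
  moreover have "jumps = (\<Union>i. Pair i ` {k. (i, k) \<in> jumps})" by auto
  ultimately show ?thesis by simp
qed

lemma jump_below:
  assumes "d (i, k) \<noteq> 0"
  obtains l where "(i, l) \<in> jumps" "l \<le> k" "d (i, l) = d (i, k)"
proof -
  define l where "l = (LEAST l. d (i, l) = d (i, k))"
  have "d (i, l) = d (i, k)" unfolding l_def by (rule LeastI[of _ k]) simp
  moreover have "l \<le> k" unfolding l_def by (rule Least_le) simp
  moreover have "d (i, m) \<noteq> d (i, k)" if "m < l" for m
    using that not_less_Least[of m "\<lambda>l. d (i, l) = d (i, k)"] by (simp add: l_def)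
  ultimately show thesis using that assms by (auto simp: jumps_def)
qed

text \<open>
  The leading monomial is kept, and only the tail is reduced: reduction of the leading monomial
  modulo \<open>d v\<close> would remove it.
\<close>

lemma reduced_element:
  assumes "d v \<noteq> 0"
  shows "\<exists>f\<in>L. f \<noteq> 0 \<and> lead f = v \<and> expo f v = d v \<and>
    (\<forall>w. w \<noteq> v \<longrightarrow> d w \<noteq> 0 \<longrightarrow> 0 \<le> expo f w \<and> expo f w < d w)"
proof -
  obtain e where e: "e \<in> L" "expo e v = d v" "\<And>w. var_less v w \<Longrightarrow> expo e w = 0"
    using d_element[of v] by blast
  define m where "m = axis (fst v) (monom (d v) (snd v))"
  have expo_m: "expo m w = (if w = v then d v else 0)" for w
    by (cases w; cases v) (auto simp: m_def expo_axis)
  have "expo (e - m) w = 0" if "\<not> var_less w v" for w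
    using that e(2) e(3)[of w] var_less_linear[of w v] by (auto simp: expo_m)
  then obtain g where g: "e - m - g \<in> L" "\<And>w. \<not> var_less w v \<Longrightarrow> expo g w = 0"
      "\<And>w. d w \<noteq> 0 \<Longrightarrow> 0 \<le> expo g w \<and> expo g w < d w"
    using reduce_below[of v "e - m"] by blast
  have "m + g \<in> L" using zx.subspace_diff[OF L e(1) g(1)] by (simp add: algebra_simps)
  moreover have expo_v: "expo (m + g) v = d v" using g(2)[of v] by (simp add: expo_m)
  moreover have "m + g \<noteq> 0 \<and> lead (m + g) = v"
  proof (rule lead_eqI)
    show "expo (m + g) v \<noteq> 0" using expo_v assms by simp
    show "expo (m + g) w = 0" if "var_less v w" for w
      using that g(2)[of w] var_less_trans[of v w v] by (auto simp: expo_m)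
  qed
  ultimately show ?thesis using g(3) by (auto simp: expo_m intro!: bexI[of _ "m + g"])
qed

text \<open>
  Subtracting a suitable multiple of an element of \<open>F\<close> cancels the leading term, and the descent
  ends at \<open>0\<close>.
\<close>

lemma span_leading_multiples:
  assumes F: "F \<subseteq> L" and mult: "leading_multiples F L"
  shows "zx_span F = L"
proof
  show "zx_span F \<subseteq> L" using F L by (rule zx.span_minimal)
  have descent: "h \<in> zx_span F" if "h \<in> L" "\<And>w. \<not> var_less w v \<Longrightarrow> expo h w = 0" for h v
    using that
  proof (induction v arbitrary: h rule: var_less_induct)
    case (1 v)
    show ?case
    proof (cases "h = 0")
      case False
      then obtain f where f: "f \<in> F" "f \<noteq> 0" "fst (lead f) = fst (lead h)"
        "snd (lead f) \<le> snd (lead h)" "expo f (lead f) dvd expo h (lead h)"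
        using leading_multiplesE[OF mult 1(2)] by blast
      obtain c where c: "expo h (lead h) = expo f (lead f) * c" using f(5) by blast
      let ?s = "snd (lead h) - snd (lead f)"
      let ?g = "monom c ?s *s f"
      have g_expo: "expo ?g w = c * expo ((shift ^^ ?s) f) w" for w
        by (cases w) (simp add: expo_monom_scale expo_shift_power)
      have lead_s: "lead ((shift ^^ ?s) f) = lead h"
        "expo ((shift ^^ ?s) f) (lead h) = expo f (lead f)"
        using lead_shift_power(2,3)[OF f(2), of ?s] f(3,4) by (simp_all add: prod_eq_iff)
      have "?g \<in> zx_span F" using f(1) by (intro zx.span_scale zx.span_base)
      moreover from this have "h - ?g \<in> L"
        using \<open>zx_span F \<subseteq> L\<close> 1(2) by (auto intro: zx.subspace_diff[OF L])
      moreover have "expo (h - ?g) w = 0" if "\<not> var_less w (lead h)" for w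
      proof (cases "w = lead h")
        case True
        then show ?thesis using c lead_s(2) by (simp add: g_expo)
      next
        case False
        then have "var_less (lead h) w" using that var_less_linear by blast
        then show ?thesis
          using expo_above_lead[of "(shift ^^ ?s) f" w] expo_above_lead[of h w] lead_s(1)
          by (simp add: g_expo)
      qed
      moreover have "var_less (lead h) v" using 1(3) expo_lead[OF False] by blast
      ultimately have "h - ?g \<in> zx_span F" using 1(1) by blast
      then show ?thesis using zx.span_add[OF _ \<open>?g \<in> zx_span F\<close>, of "h - ?g"] by simp
    qed (simp add: zx.span_zero)
  qed
  then show "L \<subseteq> zx_span F"
  proof (intro subsetI)
    fix h assume h: "h \<in> L"
    have "expo h w = 0" if "\<not> var_less w (fst (lead h), Suc (snd (lead h)))" for w
      using that by (intro expo_above_lead) (auto simp: var_less_def not_less)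
    then show "h \<in> zx_span F" by (rule descent[OF h])
  qed
qed

end

lemma finite_sorted_by_lead:
  fixes F :: "('n::{finite,linorder}) zvec set"
  assumes "finite F" "inj_on lead F"
  shows "\<exists>fs. set fs = F \<and> sorted_wrt (\<lambda>f g. var_less (lead f) (lead g)) fs"
  using assms
proof (induction F rule: finite_psubset_induct)
  case (psubset F)
  show ?case
  proof (cases "F = {}")
    case False
    then obtain g where g: "g \<in> F" "\<And>f. f \<in> F \<Longrightarrow> \<not> var_less (lead g) (lead f)"
      using finite_highest_lead[OF psubset(1) False, of lead] by blast
    have "F - {g} \<subset> F" "inj_on lead (F - {g})" using g(1) psubset(3) by (auto intro: inj_on_diff)
    then obtain fs where fs: "set fs = F - {g}" "sorted_wrt (\<lambda>f g. var_less (lead f) (lead g)) fs"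
      using psubset(2) by blast
    have "var_less (lead f) (lead g)" if "f \<in> F - {g}" for f
      using g inj_onD[OF psubset(3), of f g] that var_less_linear[of "lead f" "lead g"] by blast
    then show ?thesis using fs g(1) by (intro exI[of _ "fs @ [g]"]) (auto simp: sorted_wrt_append)
  qed auto
qed

lemma sharply_reduced_leading_multiples:
  "sharply_reduced F \<Longrightarrow> leading_multiples F (zx_span F)"
  by (simp add: sharply_reduced_def leading_multiples_def)

lemma sharply_reduced_exp_reduced:
  assumes "sharply_reduced F" "f \<in> F" "g \<in> F" "g \<noteq> f" "g \<noteq> 0"
  shows "exp_reduced f g"
  unfolding exp_reduced_def
proof (intro allI impI)
  fix k assume k: "snd (lead g) \<le> k"
  show "\<bar>expo f (fst (lead g), k)\<bar> < \<bar>expo g (lead g)\<bar>"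
  proof (cases "expo f (fst (lead g), k) = 0")
    case True
    then show ?thesis using expo_lead[OF assms(5)] by simp
  next
    case False
    then have "(expo f (fst (lead g), k), k, fst (lead g)) \<in> mons f" by (simp add: mons_iff)
    then show ?thesis using assms k unfolding sharply_reduced_def by (fastforce simp: LT_lead)
  qed
qed

text \<open>
  A multiple of a leading coefficient that is smaller than it vanishes, so sharpness implies
  G-reducedness.
\<close>

lemma sharply_reduced_imp_reduced:
  assumes "finite F" "sharply_reduced F"
  shows "reduced_groebner_basis F"
proof -
  let ?L = "zx_span F"
  have "LT_set ?L \<subseteq> zx_span (LT_set F)"
  proof
    fix m assume "m \<in> LT_set ?L"
    then obtain h where h: "h \<in> ?L - {0}" "m = mon_vec (LT h)" by (auto simp: LT_set_def)
    then obtain f where f: "f \<in> F - {0}" "mon_multiple (LT h) (LT f)"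
      using assms(2) unfolding sharply_reduced_def by blast
    then have "mon_vec (LT f) \<in> LT_set F" by (auto simp: LT_set_def)
    then have "p *s mon_vec (LT f) \<in> zx_span (LT_set F)" for p
      by (intro zx.span_scale zx.span_base)
    then show "m \<in> zx_span (LT_set F)"
      using f(2) h(2) unfolding mon_multiple_def by metis
  qed
  moreover have "LT_set F \<subseteq> LT_set ?L" using zx.span_superset[of F] by (auto simp: LT_set_def)
  ultimately have "zx_span (LT_set ?L) = zx_span (LT_set F)"
    by (intro equalityI zx.span_minimal zx.subspace_span zx.span_mono)
  moreover have "G_reduced f (F - {f})" if "f \<in> F" for f
    unfolding G_reduced_def
  proof (intro ballI)
    fix m g assume m: "m \<in> mons f" and g: "g \<in> F - {f} - {0}"
    obtain a k i where aki: "m = (a, k, i)" by (cases m)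
    then have a: "a = expo f (i, k)" "a \<noteq> 0" using m by (auto simp: mons_iff)
    have red: "exp_reduced f g"
      using sharply_reduced_exp_reduced[OF assms(2) that] g by blast
    show "\<not> mon_multiple m (LT g)"
    proof
      assume "mon_multiple m (LT g)"
      then have "i = fst (lead g)" "snd (lead g) \<le> k" "expo g (lead g) dvd a"
        using g a(2) by (auto simp: aki LT_lead mon_multiple_iff)
      then have "\<bar>a\<bar> < \<bar>expo g (lead g)\<bar>" "\<bar>expo g (lead g)\<bar> \<le> \<bar>a\<bar>"
        using red a by (auto simp: exp_reduced_def dvd_imp_le_int)
      then show False by simp
    qed
  qed
  ultimately show ?thesis using assms(1) by (simp add: reduced_groebner_basis_def groebner_basis_def)
qed

text \<open>
  At each jump of the leading coefficients one element is needed; reducing its tail makes all lower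
  coefficients smaller than the corresponding generators.
\<close>

lemma sharply_reduced_basis_exists:
  fixes L :: "('n::{finite,linorder}) zvec set"
  assumes "zx.subspace L"
  obtains fs where "zx_span (set fs) = L" "sharply_reduced (set fs)" "\<forall>f\<in>set fs. normal f"
    "sorted_wrt (\<lambda>f g. var_less (lead f) (lead g)) fs"
proof -
  obtain d where "lattice_leading L d" using lattice_leading_exists[OF assms] .
  then interpret lattice_leading L d .
  have "\<forall>v\<in>jumps. \<exists>f\<in>L. f \<noteq> 0 \<and> lead f = v \<and> expo f v = d v \<and>
      (\<forall>w. w \<noteq> v \<longrightarrow> d w \<noteq> 0 \<longrightarrow> 0 \<le> expo f w \<and> expo f w < d w)"
    using reduced_element by (auto simp: jumps_def)
  then obtain e where e: "\<And>v. v \<in> jumps \<Longrightarrow> e v \<in> L \<and> e v \<noteq> 0 \<and> lead (e v) = v \<and> expo (e v) v = d v \<and>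
      (\<forall>w. w \<noteq> v \<longrightarrow> d w \<noteq> 0 \<longrightarrow> 0 \<le> expo (e v) w \<and> expo (e v) w < d w)"
    by metis
  let ?F = "e ` jumps"
  have d_pos: "0 < d v" if "v \<in> jumps" for v
    using that d_nonneg[of v] by (cases v) (simp add: jumps_def order_less_le)
  have mult: "leading_multiples ?F L"
    unfolding leading_multiples_def
  proof
    fix h assume h: "h \<in> L - {0}"
    obtain i k where ik: "lead h = (i, k)" by fastforce
    have dvd: "d (i, k) dvd expo h (i, k)" "expo h (i, k) \<noteq> 0"
      using d_dvd_lead[of h] expo_lead[of h] h ik by auto
    then have "d (i, k) \<noteq> 0" by auto
    then obtain l where l: "(i, l) \<in> jumps" "l \<le> k" "d (i, l) = d (i, k)" by (rule jump_below)
    then have "mon_multiple (LT h) (LT (e (i, l)))"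
      using e[OF l(1)] h ik dvd by (simp add: LT_lead mon_multiple_iff)
    then show "\<exists>f\<in>?F - {0}. mon_multiple (LT h) (LT f)" using e[OF l(1)] l(1) by blast
  qed
  have span: "zx_span ?F = L" using e mult by (intro span_leading_multiples) auto
  have small: "\<bar>expo (e v) (fst u, k)\<bar> < d u"
    if uv: "u \<in> jumps" "v \<in> jumps" "u \<noteq> v" "snd u \<le> k" "expo (e v) (fst u, k) \<noteq> 0" for u v k
  proof -
    have dvd: "d (fst u, k) dvd d u" using d_dvd_mono[OF uv(4), of "fst u"] by simp
    then have le: "d (fst u, k) \<le> d u" using d_pos[OF uv(1)] by (simp add: zdvd_imp_le)
    have nz: "d (fst u, k) \<noteq> 0" using dvd d_pos[OF uv(1)] by auto
    show ?thesis
    proof (cases "(fst u, k) = v")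
      case True
      then have "snd u < k" using uv(3,4) by (auto simp: prod_eq_iff order_less_le)
      then have "d u \<noteq> d v" using uv(2) True by (auto simp: jumps_def)
      then show ?thesis using le True e[OF uv(2)] d_pos[OF uv(2)] by auto
    next
      case False
      then show ?thesis using e[OF uv(2)] nz le by fastforce
    qed
  qed
  have sharp: "sharply_reduced ?F"
    unfolding sharply_reduced_def span
  proof (intro conjI)
    show "\<forall>h\<in>L - {0}. \<exists>f\<in>?F - {0}. mon_multiple (LT h) (LT f)"
      using mult by (simp add: leading_multiples_def)
    show "\<forall>f\<in>?F. \<forall>g\<in>?F - {f, 0}. \<forall>(a, k, i)\<in>mons f.
        case LT g of (b, l, j) \<Rightarrow> i = j \<and> l \<le> k \<longrightarrow> \<bar>a\<bar> < \<bar>b\<bar>"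
    proof (intro ballI)
      fix f g x assume f: "f \<in> ?F" and g: "g \<in> ?F - {f, 0}" and x: "x \<in> mons f"
      obtain v u where vu: "v \<in> jumps" "f = e v" "u \<in> jumps" "g = e u" using f g by blast
      obtain a k i where aki: "x = (a, k, i)" by (cases x)
      have "LT g = (d u, snd u, fst u)" using e[OF vu(3)] vu(4) by (simp add: LT_lead)
      moreover have "\<bar>a\<bar> < \<bar>d u\<bar>" if "i = fst u" "snd u \<le> k"
        using small[OF vu(3,1) _ that(2)] d_pos[OF vu(3)] x g that(1) vu(2,4)
        by (auto simp: aki mons_iff)
      ultimately show "case x of (a, k, i) \<Rightarrow>
          case LT g of (b, l, j) \<Rightarrow> i = j \<and> l \<le> k \<longrightarrow> \<bar>a\<bar> < \<bar>b\<bar>"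
        by (simp add: aki)
    qed
  qed
  have "normal f" if "f \<in> ?F" for f using that e d_pos by (auto simp: normal_iff)
  moreover have "inj_on lead ?F" using e by (auto intro!: inj_onI)
  then obtain fs where "set fs = ?F" "sorted_wrt (\<lambda>f g. var_less (lead f) (lead g)) fs"
    using finite_sorted_by_lead[of ?F] finite_jumps by blast
  ultimately show thesis using that[of fs] span sharp by simp
qed

section \<open>The three descriptions\<close>

context difference_field
begin

lemma character_presentation_imp:
  assumes "character_presentation \<sigma> I bs"
  shows "laurent_binomial_ideal \<sigma> I" "proper_ideal \<sigma> I"
proof -
  obtain \<rho> where rho: "character_on \<sigma> (zx_span (fst ` set bs)) \<rho>"
      "I = character_ideal \<sigma> (zx_span (fst ` set bs)) \<rho>"
    using assms by (auto simp: character_presentation_def)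
  show "proper_ideal \<sigma> I"
    using character_ideal_proper[OF zx.subspace_span rho(1)] rho(2) by (simp add: proper_iff)
  show "laurent_binomial_ideal \<sigma> I"
    unfolding laurent_binomial_ideal_def rho(2) character_ideal_altdef
    using laurent_binomial_lbinom by blast
qed

lemma gen_lbinom_presentation:
  assumes "I = gen_sigma_ideal \<sigma> (lbinom ` B)"
  shows "laurent_binomial_ideal \<sigma> I"
  unfolding laurent_binomial_ideal_def assms using laurent_binomial_lbinom by blast

text \<open>
  The character of the proper ideal lives on a lattice that contains the supports of the
  generators, and its restriction to their span already determines the ideal.
\<close>

lemma proper_gen_lbinom_character:
  assumes "\<And>b. b \<in> B \<Longrightarrow> snd b \<noteq> 0" "gen_sigma_ideal \<sigma> (lbinom ` B) \<noteq> UNIV"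
  obtains \<rho> where "character_on \<sigma> (zx_span (fst ` B)) \<rho>" "\<And>b. b \<in> B \<Longrightarrow> \<rho> (fst b) = snd b"
    "gen_sigma_ideal \<sigma> (lbinom ` B) = character_ideal \<sigma> (zx_span (fst ` B)) \<rho>"
proof -
  let ?J = "gen_sigma_ideal \<sigma> (lbinom ` B)"
  obtain L \<rho> where L: "zx.subspace L" "character_on \<sigma> L \<rho>"
      "\<And>b. lbinom b \<in> ?J \<Longrightarrow> snd b \<noteq> 0 \<Longrightarrow> fst b \<in> L \<and> \<rho> (fst b) = snd b"
    using proper_binomial_ideal_character[OF gen_lbinom_presentation[OF refl] assms(2)] by metis
  have B: "fst b \<in> L \<and> \<rho> (fst b) = snd b" if "b \<in> B" for b
    using L(3)[of b] assms(1)[OF that] gen_superset[of "lbinom ` B" \<sigma>] that by blast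
  then have "zx_span (fst ` B) \<subseteq> L" using L(1) by (intro zx.span_minimal) auto
  then have "character_on \<sigma> (zx_span (fst ` B)) \<rho>" by (rule character_on_subset[OF L(2)])
  then show thesis using that gen_eq_character_ideal B by blast
qed

lemma chain_presentation_character:
  assumes "chain_presentation \<sigma> I bs"
  obtains \<rho> where "character_on \<sigma> (zx_span (fst ` set bs)) \<rho>"
    "I = character_ideal \<sigma> (zx_span (fst ` set bs)) \<rho>"
    "leading_multiples (fst ` set bs) (zx_span (fst ` set bs))" "reduced_chain (map fst bs)"
proof -
  have bs: "\<And>b. b \<in> set bs \<Longrightarrow> normal_binom b" "coherent_chain \<sigma> bs"
      "ascending_chain (map lbinom bs)" "I = gen_sigma_ideal \<sigma> (lbinom ` set bs)"
    using assms by (auto simp: chain_presentation_def)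
  have chain: "reduced_chain (map fst bs)"
    using ascending_chain_lbinom[of bs] bs(1,3) by (auto simp: normal_binom_def normal_def)
  obtain \<rho> where "character_on \<sigma> (zx_span (fst ` set bs)) \<rho>"
      "\<And>b. b \<in> set bs \<Longrightarrow> \<rho> (fst b) = snd b"
      "leading_multiples (fst ` set bs) (zx_span (fst ` set bs))"
    using coherent_chain_character[OF bs(1) chain bs(2)] by metis
  then show thesis using that gen_eq_character_ideal chain bs(4) by blast
qed

lemma chain_presentation_characteristic:
  assumes "chain_presentation \<sigma> I bs"
  shows "characteristic_set I (map lbinom bs)"
proof -
  obtain \<rho> where rho: "character_on \<sigma> (zx_span (fst ` set bs)) \<rho>"
    "I = character_ideal \<sigma> (zx_span (fst ` set bs)) \<rho>"
    "leading_multiples (fst ` set bs) (zx_span (fst ` set bs))" "reduced_chain (map fst bs)"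
    by (rule chain_presentation_character[OF assms])
  have "fst b \<noteq> 0 \<and> snd b \<noteq> 0 \<and> lbinom b \<in> I" if "b \<in> set bs" for b
    using assms that gen_superset[of "lbinom ` set bs" \<sigma>]
    by (auto simp: chain_presentation_def normal_binom_def normal_def)
  then show ?thesis by (rule characteristic_set_lbinom[OF zx.subspace_span rho(1,2) _ rho(4,3)])
qed

lemma sharply_reduced_chain:
  assumes "sharply_reduced (set fs)" "\<forall>f\<in>set fs. f \<noteq> 0"
    and "sorted_wrt (\<lambda>f g. var_less (lead f) (lead g)) fs"
  shows "reduced_chain fs"
  unfolding reduced_chain_def
proof (rule sorted_wrt_mono_rel[OF _ assms(3)])
  fix f g assume fg: "f \<in> set fs" "g \<in> set fs" "var_less (lead f) (lead g)"
  then have "f \<noteq> g" by auto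
  then show "var_less (lead f) (lead g) \<and> exp_reduced g f"
    using fg assms sharply_reduced_exp_reduced by blast
qed

text \<open>
  The order of leading terms also compares coefficients; for a sharply reduced set the second case
  is excluded, because the higher element is reduced with respect to the lower.
\<close>

lemma mon_less_LT_cases:
  assumes "f \<noteq> 0" "g \<noteq> 0" "mon_less (LT f) (LT g)"
  shows "var_less (lead f) (lead g) \<or> lead f = lead g \<and> \<bar>expo f (lead f)\<bar> < \<bar>expo g (lead g)\<bar>"
  using assms by (auto simp: LT_lead mon_less_def var_less_def prod_eq_iff)

lemma groebner_presentation_characteristic:
  assumes "groebner_presentation \<sigma> I bs" and sharp: "sharply_reduced (fst ` set bs)"
    and sorted: "sorted_wrt (\<lambda>f g. mon_less (LT f) (LT g)) (map fst bs)"
  shows "characteristic_set I (map lbinom bs)"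
proof -
  have bs: "\<And>b. b \<in> set bs \<Longrightarrow> normal_binom b" "I = gen_sigma_ideal \<sigma> (lbinom ` set bs)" "I \<noteq> UNIV"
    using assms by (auto simp: groebner_presentation_def proper_iff)
  then have nz: "fst b \<noteq> 0 \<and> snd b \<noteq> 0 \<and> lbinom b \<in> I" if "b \<in> set bs" for b
    using that gen_superset[of "lbinom ` set bs" \<sigma>] by (auto simp: normal_binom_def normal_def)
  obtain \<rho> where rho: "character_on \<sigma> (zx_span (fst ` set bs)) \<rho>"
      "I = character_ideal \<sigma> (zx_span (fst ` set bs)) \<rho>"
    using proper_gen_lbinom_character[of "set bs"] nz bs(2,3) by metis
  have "sorted_wrt (\<lambda>f g. var_less (lead f) (lead g)) (map fst bs)"
  proof (rule sorted_wrt_mono_rel[OF _ sorted])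
    fix f g assume fg: "f \<in> set (map fst bs)" "g \<in> set (map fst bs)" "mon_less (LT f) (LT g)"
    then have "f \<noteq> 0" "g \<noteq> 0" using nz by auto
    moreover have "f \<noteq> g" using fg(3) by (auto simp: mon_less_def split: prod.splits)
    then have "\<bar>expo g (lead f)\<bar> < \<bar>expo f (lead f)\<bar>"
      using sharply_reduced_exp_reduced[OF sharp, of g f] fg \<open>f \<noteq> 0\<close>
      by (auto simp: exp_reduced_def dest: spec[of _ "snd (lead f)"])
    ultimately show "var_less (lead f) (lead g)" using mon_less_LT_cases[OF _ _ fg(3)] by auto
  qed
  then have "reduced_chain (map fst bs)" using sharp nz by (intro sharply_reduced_chain) auto
  then show ?thesis
    using characteristic_set_lbinom[OF zx.subspace_span rho nz]
      sharply_reduced_leading_multiples[OF sharp] by blast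
qed

text \<open>
  The same list serves all three descriptions: a sharply reduced Groebner basis of the lattice,
  ordered by leading terms, with the values of the character.
\<close>

lemma presentations_exist:
  fixes I :: "('a, 'n::{finite,linorder}) laurent set"
  assumes "laurent_binomial_ideal \<sigma> I" "proper_ideal \<sigma> I"
  obtains bs where "groebner_presentation \<sigma> I bs" "sharply_reduced (fst ` set bs)"
    "sorted_wrt (\<lambda>f g. mon_less (LT f) (LT g)) (map fst bs)"
    "chain_presentation \<sigma> I bs" "character_presentation \<sigma> I bs"
proof -
  obtain L \<rho> where L: "zx.subspace L" "character_on \<sigma> L \<rho>" "I = character_ideal \<sigma> L \<rho>"
    using proper_binomial_ideal_character[OF assms(1)] assms(2) by (metis proper_iff)
  obtain fs where fs: "zx_span (set fs) = L" "sharply_reduced (set fs)" "\<forall>f\<in>set fs. normal f"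
      "sorted_wrt (\<lambda>f g. var_less (lead f) (lead g)) fs"
    by (rule sharply_reduced_basis_exists[OF L(1)])
  define bs where "bs = map (\<lambda>f. (f, \<rho> f)) fs"
  have map_fst: "map fst bs = fs" by (simp add: bs_def comp_def)
  then have set_fst: "fst ` set bs = set fs" by (metis set_map)
  have in_L: "f \<in> L" if "f \<in> set fs" for f using fs(1) zx.span_base that by blast
  have graph: "set bs \<subseteq> character_graph L \<rho>" using in_L by (auto simp: bs_def character_graph_def)
  have normal: "\<forall>b\<in>set bs. normal_binom b"
    using fs(3) in_L L(2) by (auto simp: bs_def normal_binom_def character_on_def)
  have nz: "\<forall>f\<in>set fs. f \<noteq> 0" using fs(3) by (auto simp: normal_def)
  have chain: "reduced_chain fs" using sharply_reduced_chain[OF fs(2) nz fs(4)] .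
  have gen: "I = gen_sigma_ideal \<sigma> (lbinom ` set bs)"
  proof -
    have "\<rho> (fst b) = snd b" if "b \<in> set bs" for b using that by (auto simp: bs_def)
    then show ?thesis
      using gen_eq_character_ideal[of "set bs" \<rho>] L(2,3) unfolding set_fst fs(1) by simp
  qed
  have mult: "leading_multiples (fst ` set bs) L"
    using sharply_reduced_leading_multiples[OF fs(2)] fs(1) set_fst by simp
  have sorted: "sorted_wrt (\<lambda>f g. mon_less (LT f) (LT g)) fs"
    by (rule sorted_wrt_mono_rel[OF _ fs(4)]) (use nz mon_less_LT in blast)
  have "sorted_wrt (\<lambda>f g. var_less (lead f) (lead g)) gs \<Longrightarrow> distinct gs" for gs :: "'n zvec list"
    by (induction gs) auto
  then have "distinct fs" using fs(4) by blast
  then have "groebner_presentation \<sigma> I bs"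
    unfolding groebner_presentation_def map_fst set_fst
    using normal sharply_reduced_imp_reduced[OF finite_set fs(2)] gen assms(2) by metis
  moreover have "fst b \<noteq> 0 \<and> snd b \<noteq> 0" if "b \<in> set bs" for b
    using normal that by (simp add: normal_binom_def normal_def)
  then have "ascending_chain (map lbinom bs)"
    using ascending_chain_lbinom[of bs] chain map_fst by simp
  then have "chain_presentation \<sigma> I bs"
    unfolding chain_presentation_def
    using normal gen regular_chain_lbinom[of bs]
      coherent_chain_lbinom[OF L(1,2) graph normal _ mult] chain map_fst by metis
  moreover have "character_presentation \<sigma> I bs"
    unfolding character_presentation_def set_fst fs(1)
    using L(2,3) in_L binom_group_nonzero[OF binom_group_character_graph(1)[OF L(2,1)]] graph
    by (intro exI[of _ \<rho>]) (auto simp: bs_def)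
  ultimately show thesis using that[of bs] fs(2) sorted by (simp add: map_fst set_fst)
qed

end

theorem theorem1p1:
  fixes \<sigma> :: "'a::field_char_0 \<Rightarrow> 'a"
    and I :: "('a, 'n::{finite,linorder}) laurent set"
  assumes "inversive_difference_field \<sigma>"
  shows
    "(laurent_binomial_ideal \<sigma> I \<and> proper_ideal \<sigma> I \<longleftrightarrow> (\<exists>bs. groebner_presentation \<sigma> I bs)) \<and>
     (laurent_binomial_ideal \<sigma> I \<and> proper_ideal \<sigma> I \<longleftrightarrow> (\<exists>bs. chain_presentation \<sigma> I bs)) \<and>
     (laurent_binomial_ideal \<sigma> I \<and> proper_ideal \<sigma> I \<longleftrightarrow> (\<exists>bs. character_presentation \<sigma> I bs)) \<and>
     (\<forall>bs. groebner_presentation \<sigma> I bs \<and> sharply_reduced (fst ` set bs) \<and>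
           sorted_wrt (\<lambda>f g. mon_less (LT f) (LT g)) (map fst bs) \<longrightarrow>
        characteristic_set I (map lbinom bs)) \<and>
     (laurent_binomial_ideal \<sigma> I \<and> proper_ideal \<sigma> I \<longrightarrow>
        (\<exists>bs. groebner_presentation \<sigma> I bs \<and> sharply_reduced (fst ` set bs) \<and>
              sorted_wrt (\<lambda>f g. mon_less (LT f) (LT g)) (map fst bs))) \<and>
     (\<forall>bs. chain_presentation \<sigma> I bs \<longrightarrow> characteristic_set I (map lbinom bs))"
proof -
  interpret inversive_difference_field \<sigma> by (rule assms)
  let ?P = "laurent_binomial_ideal \<sigma> I \<and> proper_ideal \<sigma> I"
  have from_groebner: ?P if "groebner_presentation \<sigma> I bs" for bs
    using that gen_lbinom_presentation by (auto simp: groebner_presentation_def)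
  have from_chain: ?P if chain: "chain_presentation \<sigma> I bs" for bs
  proof -
    obtain \<rho> where rho: "character_on \<sigma> (zx_span (fst ` set bs)) \<rho>"
      "I = character_ideal \<sigma> (zx_span (fst ` set bs)) \<rho>"
      using chain_presentation_character[OF chain] by blast
    have "laurent_binomial_ideal \<sigma> I"
      using chain gen_lbinom_presentation by (auto simp: chain_presentation_def)
    then show ?thesis
      using character_ideal_proper[OF zx.subspace_span rho(1)] rho(2) by (simp add: proper_iff)
  qed
  have exist: "\<exists>bs. groebner_presentation \<sigma> I bs \<and> sharply_reduced (fst ` set bs) \<and>
      sorted_wrt (\<lambda>f g. mon_less (LT f) (LT g)) (map fst bs) \<and>
      chain_presentation \<sigma> I bs \<and> character_presentation \<sigma> I bs" if ?P
    using that by (elim conjE) (rule presentations_exist, blast+)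
  show ?thesis
  proof (intro conjI)
    show "?P \<longleftrightarrow> (\<exists>bs. groebner_presentation \<sigma> I bs)"
      using from_groebner exist by blast
    show "?P \<longleftrightarrow> (\<exists>bs. chain_presentation \<sigma> I bs)"
      using from_chain exist by blast
    show "?P \<longleftrightarrow> (\<exists>bs. character_presentation \<sigma> I bs)"
      using character_presentation_imp exist by blast
    show "?P \<longrightarrow> (\<exists>bs. groebner_presentation \<sigma> I bs \<and> sharply_reduced (fst ` set bs) \<and>
        sorted_wrt (\<lambda>f g. mon_less (LT f) (LT g)) (map fst bs))"
      using exist by blast
  qed (use groebner_presentation_characteristic chain_presentation_characteristic in blast)+
qed

end
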